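(* Let $G$ be a finite group, and pick $H\leq G$. The Schurian scheme of $(G,H)$ is isomorphic to a roux scheme if and only if $(G,H)$ is a Higman pair.
   Context: Association scheme: a sequence of $\{0,1\}$-matrices $A_1=I,A_2,\dots,A_k$ summing to the all-ones matrix whose span is a $*$-algebra under matrix multiplication. Two schemes are isomorphic if conjugating the adjacency matrices of one by some permutation matrix produces the adjacency matrices of the other. Schurian scheme of $(G,H)$: the scheme on $G/H$ with adjacency matrices $A_{HaH}$, one for each double coset, where $(A_{HaH})_{xH,yH}=1$ if $y^{-1}x\in HaH$ and $0$ otherwise. Higman pair: $H$ is a proper subgroup of the finite group $G$ and, with $K=N_G(H)$ the normalizer of $H$ in $G$, there exists $b\in G\setminus K$ such that: (H1) $G$ acts doubly transitively on $G/K$; (H2) $K/H$ is abelian; (H3) $HbH=Hb^{-1}H$; (H4) $aba^{-1}\in HbH$ for every $a\in K$; (H5) $a\in K$ satisfies $ab\in HbH$ only if $a\in H$. Roux: for a finite abelian group $\Gamma$ (identified with its image in the group ring $\mathbb{C}[\Gamma]$), an $n\times n$ matrix $B$ with entries in $\mathbb{C}[\Gamma]$ such that (R1) $B_{ii}=0$ for every $i$; (R2) $B_{ij}\in\Gamma$ for $i\ne j$; (R3) $B_{ji}=(B_{ij})^{-1}$ for $i\ne j$; (R4) the matrices $\{gI\}_{g\in\Gamma}$ and $\{gB\}_{g\in\Gamma}$ span an algebra. Let $\lceil\cdot\rfloor\colon\mathbb{C}[\Gamma]^{n\times n}\to\mathbb{C}^{n|\Gamma|\times n|\Gamma|}$ apply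 the Cayley (regular) representation of $\Gamma$, extended linearly to $\mathbb{C}[\Gamma]$, to each entry; for $x\in\Gamma$, the $(g,h)$ entry of the image of $x$ is $1$ if $xh=g$ and $0$ otherwise. The roux scheme of a roux $B$ for $\Gamma$ is the commutative association scheme with adjacency matrices $\{\lceil gI\rfloor\}_{g\in\Gamma}$ and $\{\lceil gB\rfloor\}_{g\in\Gamma}$. A roux scheme is a scheme that arises in this way from some roux.
   Formalization: The roux is required to have size n ≥ 3 (for n = 2 the claim fails: G = C_2, H = 1 has a roux scheme but is not a Higman pair); the finite abelian group Γ is taken, up to isomorphism, with natural numbers as elements. *)

theory Defs
  imports
    Complex_Main
    "HOL-Library.Function_Algebras"
    "HOL-Algebra.Left_Coset"
    "HOL-Algebra.Group_Action"
begin

section \<open>Association schemes\<close>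

text \<open>
  Complex matrices have arbitrary (finite) index sets. A matrix with rows indexed by \<open>Y\<close> and
  columns indexed by \<open>X\<close> is a function that vanishes off \<open>Y \<times> X\<close>, so that equality of
  matrices is equality of functions. Addition, zero and finite sums of matrices are the pointwise
  ones of Function_Algebras; the pointwise product of that theory is never used on matrices.
\<close>

type_synonym ('y, 'x) cmat = "'y \<Rightarrow> 'x \<Rightarrow> complex"

definition mat_mult :: "'x set \<Rightarrow> ('y, 'x) cmat \<Rightarrow> ('x, 'z) cmat \<Rightarrow> ('y, 'z) cmat" where
  "mat_mult X A B = (\<lambda>i j. \<Sum>k\<in>X. A i k * B k j)"

definition mat_adjoint :: "('y, 'x) cmat \<Rightarrow> ('x, 'y) cmat" where
  "mat_adjoint A = (\<lambda>i j. cnj (A j i))"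

definition id_mat :: "'x set \<Rightarrow> ('x, 'x) cmat" where
  "id_mat X = (\<lambda>i j. if i \<in> X \<and> i = j then 1 else 0)"

definition ones_mat :: "'x set \<Rightarrow> ('x, 'x) cmat" where
  "ones_mat X = (\<lambda>i j. if i \<in> X \<and> j \<in> X then 1 else 0)"

definition mat_span :: "('y, 'x) cmat set \<Rightarrow> ('y, 'x) cmat set" where
  "mat_span = Modules.module.span (\<lambda>c A i j. c * A i j)"

text \<open>A scheme is given by its index set (its points) and its set of adjacency matrices.\<close>

type_synonym 'x scheme = "'x set \<times> ('x, 'x) cmat set"

definition association_scheme :: "'x scheme \<Rightarrow> bool" where
  "association_scheme \<S> \<longleftrightarrow> (case \<S> of (X, \<A>) \<Rightarrow>
     finite X \<and> finite \<A> \<and>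
     (\<forall>A\<in>\<A>. (\<forall>i\<in>X. \<forall>j\<in>X. A i j \<in> {0, 1}) \<and> (\<forall>i j. i \<notin> X \<or> j \<notin> X \<longrightarrow> A i j = 0)) \<and>
     id_mat X \<in> \<A> \<and>
     (\<Sum>A\<in>\<A>. A) = ones_mat X \<and>
     (\<forall>A\<in>mat_span \<A>. \<forall>B\<in>mat_span \<A>. mat_mult X A B \<in> mat_span \<A>) \<and>
     (\<forall>A\<in>mat_span \<A>. mat_adjoint A \<in> mat_span \<A>))"

text \<open>
  The permutation matrix of a bijection \<open>f\<close> from \<open>X\<close> onto another index set; its inverse
  is its adjoint.
\<close>

definition perm_mat :: "'x set \<Rightarrow> ('x \<Rightarrow> 'y) \<Rightarrow> ('y, 'x) cmat" where
  "perm_mat X f = (\<lambda>y x. if x \<in> X \<and> y = f x then 1 else 0)"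

definition scheme_isomorphic :: "'x scheme \<Rightarrow> 'y scheme \<Rightarrow> bool" where
  "scheme_isomorphic \<S> \<T> \<longleftrightarrow> association_scheme \<S> \<and> association_scheme \<T> \<and>
     (\<exists>f. bij_betw f (fst \<S>) (fst \<T>) \<and>
        (\<lambda>A. mat_mult (fst \<S>) (mat_mult (fst \<S>) (perm_mat (fst \<S>) f) A)
                (mat_adjoint (perm_mat (fst \<S>) f))) ` snd \<S> = snd \<T>)"

section \<open>Schurian schemes and Higman pairs\<close>

definition double_coset :: "('a, 'b) monoid_scheme \<Rightarrow> 'a set \<Rightarrow> 'a \<Rightarrow> 'a set" where
  "double_coset G H a = (H #>\<^bsub>G\<^esub> a) <#>\<^bsub>G\<^esub> H"

text \<open>
  The matrix of a double coset \<open>D\<close> of \<open>H\<close>; the condition does not depend on the chosen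
  representatives \<open>x\<close> and \<open>y\<close>.
\<close>

definition schurian_adj ::
  "('a, 'b) monoid_scheme \<Rightarrow> 'a set \<Rightarrow> 'a set \<Rightarrow> ('a set, 'a set) cmat" where
  "schurian_adj G H D = (\<lambda>U V.
     if \<exists>x\<in>carrier G. \<exists>y\<in>carrier G. U = x <#\<^bsub>G\<^esub> H \<and> V = y <#\<^bsub>G\<^esub> H \<and> inv\<^bsub>G\<^esub> y \<otimes>\<^bsub>G\<^esub> x \<in> D
     then 1 else 0)"

definition schurian_scheme :: "('a, 'b) monoid_scheme \<Rightarrow> 'a set \<Rightarrow> 'a set scheme" where
  "schurian_scheme G H =
     (lcosets\<^bsub>G\<^esub> H, (\<lambda>a. schurian_adj G H (double_coset G H a)) ` carrier G)"

definition doubly_transitive ::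
  "('a, 'b) monoid_scheme \<Rightarrow> 'e set \<Rightarrow> ('a \<Rightarrow> 'e \<Rightarrow> 'e) \<Rightarrow> bool" where
  "doubly_transitive G E \<phi> \<longleftrightarrow>
     (\<forall>x\<in>E. \<forall>y\<in>E. \<forall>x'\<in>E. \<forall>y'\<in>E. x \<noteq> y \<longrightarrow> x' \<noteq> y' \<longrightarrow>
        (\<exists>g\<in>carrier G. \<phi> g x = x' \<and> \<phi> g y = y'))"

definition higman_pair :: "('a, 'b) monoid_scheme \<Rightarrow> 'a set \<Rightarrow> bool" where
  "higman_pair G H \<longleftrightarrow>
     group G \<and> finite (carrier G) \<and> subgroup H G \<and> H \<noteq> carrier G \<and>
     (let K = normalizer G H in
      \<exists>b \<in> carrier G - K.
        doubly_transitive G (lcosets\<^bsub>G\<^esub> K) (l_coset G) \<and>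
        comm_group ((G\<lparr>carrier := K\<rparr>) Mod H) \<and>
        double_coset G H b = double_coset G H (inv\<^bsub>G\<^esub> b) \<and>
        (\<forall>a\<in>K. a \<otimes>\<^bsub>G\<^esub> b \<otimes>\<^bsub>G\<^esub> inv\<^bsub>G\<^esub> a \<in> double_coset G H b) \<and>
        (\<forall>a\<in>K. a \<otimes>\<^bsub>G\<^esub> b \<in> double_coset G H b \<longrightarrow> a \<in> H))"

section \<open>Roux\<close>

text \<open>
  Elements of the complex group ring of a finite group \<open>\<Gamma>\<close> are the complex functions
  vanishing off \<open>carrier \<Gamma>\<close>, with pointwise addition and convolution as product;
  \<open>gr_of\<close> is the embedding of the group. An \<open>n \<times> n\<close> matrix over the group ring is a
  function on \<open>nat \<times> nat\<close> vanishing off \<open>{..<n} \<times> {..<n}\<close>.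
\<close>

definition gr_of :: "'c \<Rightarrow> 'c \<Rightarrow> complex" where
  "gr_of g = (\<lambda>x. if x = g then 1 else 0)"

definition gr_mult ::
  "('c, 'd) monoid_scheme \<Rightarrow> ('c \<Rightarrow> complex) \<Rightarrow> ('c \<Rightarrow> complex) \<Rightarrow> 'c \<Rightarrow> complex" where
  "gr_mult \<Gamma> x y = (\<lambda>g. \<Sum>(h, k) | h \<in> carrier \<Gamma> \<and> k \<in> carrier \<Gamma> \<and> h \<otimes>\<^bsub>\<Gamma>\<^esub> k = g. x h * y k)"

type_synonym 'c grmat = "nat \<Rightarrow> nat \<Rightarrow> 'c \<Rightarrow> complex"

definition grmat_mult :: "('c, 'd) monoid_scheme \<Rightarrow> nat \<Rightarrow> 'c grmat \<Rightarrow> 'c grmat \<Rightarrow> 'c grmat" where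
  "grmat_mult \<Gamma> n M N = (\<lambda>i j. \<Sum>k<n. gr_mult \<Gamma> (M i k) (N k j))"

definition grmat_id :: "('c, 'd) monoid_scheme \<Rightarrow> nat \<Rightarrow> 'c grmat" where
  "grmat_id \<Gamma> n = (\<lambda>i j. if i < n \<and> i = j then gr_of \<one>\<^bsub>\<Gamma>\<^esub> else 0)"

text \<open>The matrix \<open>gM\<close> for a group element \<open>g\<close>.\<close>

definition grmat_smult :: "('c, 'd) monoid_scheme \<Rightarrow> 'c \<Rightarrow> 'c grmat \<Rightarrow> 'c grmat" where
  "grmat_smult \<Gamma> g M = (\<lambda>i j. gr_mult \<Gamma> (gr_of g) (M i j))"

definition grmat_span :: "'c grmat set \<Rightarrow> 'c grmat set" where
  "grmat_span = Modules.module.span (\<lambda>c M i j g. c * M i j g)"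

text \<open>The matrices \<open>gI\<close> and \<open>gB\<close>.\<close>

definition roux_gens :: "('c, 'd) monoid_scheme \<Rightarrow> nat \<Rightarrow> 'c grmat \<Rightarrow> 'c grmat set" where
  "roux_gens \<Gamma> n B =
     (\<lambda>g. grmat_smult \<Gamma> g (grmat_id \<Gamma> n)) ` carrier \<Gamma> \<union> (\<lambda>g. grmat_smult \<Gamma> g B) ` carrier \<Gamma>"

definition roux :: "('c, 'd) monoid_scheme \<Rightarrow> nat \<Rightarrow> 'c grmat \<Rightarrow> bool" where
  "roux \<Gamma> n B \<longleftrightarrow>
     comm_group \<Gamma> \<and> finite (carrier \<Gamma>) \<and>
     (\<forall>i j. i \<ge> n \<or> j \<ge> n \<longrightarrow> B i j = 0) \<and>
     (\<forall>i<n. B i i = 0) \<and>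
     (\<forall>i<n. \<forall>j<n. i \<noteq> j \<longrightarrow> B i j \<in> gr_of ` carrier \<Gamma>) \<and>
     (\<forall>i<n. \<forall>j<n. i \<noteq> j \<longrightarrow>
        (\<forall>g\<in>carrier \<Gamma>. B i j = gr_of g \<longrightarrow> B j i = gr_of (inv\<^bsub>\<Gamma>\<^esub> g))) \<and>
     (\<forall>M\<in>grmat_span (roux_gens \<Gamma> n B). \<forall>N\<in>grmat_span (roux_gens \<Gamma> n B).
        grmat_mult \<Gamma> n M N \<in> grmat_span (roux_gens \<Gamma> n B))"

definition cayley :: "('c, 'd) monoid_scheme \<Rightarrow> ('c \<Rightarrow> complex) \<Rightarrow> ('c, 'c) cmat" where
  "cayley \<Gamma> x = (\<lambda>g h. if g \<in> carrier \<Gamma> \<and> h \<in> carrier \<Gamma>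
     then \<Sum>k\<in>carrier \<Gamma>. x k * (if k \<otimes>\<^bsub>\<Gamma>\<^esub> h = g then 1 else 0) else 0)"

text \<open>
  The block matrix obtained by applying \<open>cayley\<close> entrywise; its rows and columns are indexed
  by \<open>{..<n} \<times> carrier \<Gamma>\<close>.
\<close>

definition grmat_lift ::
  "('c, 'd) monoid_scheme \<Rightarrow> 'c grmat \<Rightarrow> (nat \<times> 'c, nat \<times> 'c) cmat" where
  "grmat_lift \<Gamma> M = (\<lambda>(i, g) (j, h). cayley \<Gamma> (M i j) g h)"

definition roux_scheme ::
  "('c, 'd) monoid_scheme \<Rightarrow> nat \<Rightarrow> 'c grmat \<Rightarrow> (nat \<times> 'c) scheme" where
  "roux_scheme \<Gamma> n B = ({..<n} \<times> carrier \<Gamma>, grmat_lift \<Gamma> ` roux_gens \<Gamma> n B)"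

end

theory Submission
  imports Defs "HOL-Algebra.Zassenhaus" "HOL-Algebra.Weak_Morphisms"
begin

text \<open>
  Relations of the Schurian scheme are the double cosets \<open>HaH\<close>; those with \<open>a \<in> K = N\<^sub>G(H)\<close> are
  permutation matrices and form the group \<open>K/H\<close>, acting on \<open>G/H\<close> by right multiplication with
  orbits the cosets of \<open>K\<close>. In a roux scheme with \<open>n \<ge> 3\<close> the permutation matrices are exactly the \<open>gI\<close>,
  so an isomorphism identifies \<open>\<Gamma>\<close> with \<open>K/H\<close> and the \<open>n\<close> blocks with \<open>G/K\<close>; the double coset of
  \<open>b\<close> is the one corresponding to \<open>B\<close>, and (H1)-(H5) are read off from \<open>gB = Bg\<close>,
  \<open>B\<^sup>* = B\<close> and the distinctness of the \<open>gB\<close>.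
  Conversely, for a Higman pair every \<open>x \<notin> K\<close> lies in \<open>HabH\<close> for some \<open>a \<in> K\<close>, unique modulo \<open>H\<close>;
  writing \<open>\<theta> x\<close> for its class and \<open>x\<^sub>i\<close> for representatives of \<open>G/K\<close>, the roux is
  \<open>B\<^sub>i\<^sub>j = \<theta> (x\<^sub>j\<inverse> x\<^sub>i)\<inverse>\<close>. It spans an algebra because its lift is a relabelled Schurian scheme.
\<close>

section \<open>Matrices and their spans\<close>

text \<open>The bound \<open>3 \<le> n\<close> is essential: for \<open>n = 2\<close> every
  \<open>gB\<close> is a permutation matrix as well, all double cosets are single cosets,
  \<open>H\<close> is normal, and no \<open>b\<close> outside \<open>K\<close> exists. Thus the
  scheme of the trivial subgroup in the group of order 2 comes from a roux with
  \<open>n = 2\<close>, but not from a Higman pair. Conversely, a Higman pair has at least three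
  cosets of \<open>K\<close> because of (H5). \<open>\<Gamma>\<close> lives on \<open>nat\<close>
  since a statement cannot quantify over types, and every finite group has a copy there. The
  obstacle in the converse is (R4), as the square of \<open>B\<close> is not easily computed.
  Instead, the span of the Schurian scheme is identified with the matrices invariant under left
  translation by \<open>G\<close>, and these are clearly closed under products. This passes to the
  relabelled scheme, and then to matrices over the group ring because the Cayley lift is linear,
  multiplicative and faithful.\<close>

lemma module_cmat: "Modules.module (\<lambda>(c::complex) (A :: ('y, 'x) cmat) i j. c * A i j)"
  by unfold_locales (auto simp: fun_eq_iff algebra_simps)

lemma module_grmat: "Modules.module (\<lambda>(c::complex) (M :: 'c grmat) i j g. c * M i j g)"
  by unfold_locales (auto simp: fun_eq_iff algebra_simps)

lemma sum_fun2_apply: "(\<Sum>a\<in>S. f a) i j = (\<Sum>a\<in>S. f a i j)"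
  for f :: "'a \<Rightarrow> 'b \<Rightarrow> 'c \<Rightarrow> 'd::comm_monoid_add"
  by (induction S rule: infinite_finite_induct) auto

text \<open>The span is the algebra of all matrices supported on \<open>X\<close> and invariant
  under \<open>\<Phi>\<close>: transitivity on each relation forces an invariant matrix to be
  constant there. Invariance survives products because a bijection reindexes the inner sum, and it
  survives adjoints trivially.\<close>

lemma association_schemeI_transitive:
  fixes \<A> :: "('x, 'x) cmat set" and \<Phi> :: "('x \<Rightarrow> 'x) set"
  assumes finX: "finite X" and finA: "finite \<A>"
    and entries: "\<And>A i j. A \<in> \<A> \<Longrightarrow> A i j \<in> {0, 1}"
    and supp: "\<And>A i j. A \<in> \<A> \<Longrightarrow> i \<notin> X \<or> j \<notin> X \<Longrightarrow> A i j = 0"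
    and part: "\<And>i j. i \<in> X \<Longrightarrow> j \<in> X \<Longrightarrow> \<exists>!A. A \<in> \<A> \<and> A i j = 1"
    and id: "id_mat X \<in> \<A>"
    and bij: "\<And>\<phi>. \<phi> \<in> \<Phi> \<Longrightarrow> bij_betw \<phi> X X"
    and inv: "\<And>\<phi> A i j. \<phi> \<in> \<Phi> \<Longrightarrow> A \<in> \<A> \<Longrightarrow> i \<in> X \<Longrightarrow> j \<in> X \<Longrightarrow> A (\<phi> i) (\<phi> j) = A i j"
    and trans: "\<And>A i j i' j'. A \<in> \<A> \<Longrightarrow> A i j = 1 \<Longrightarrow> A i' j' = 1 \<Longrightarrow>
                  \<exists>\<phi>\<in>\<Phi>. \<phi> i = i' \<and> \<phi> j = j'"
  shows "association_scheme (X, \<A>)"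
proof -
  define Inv where "Inv = {M :: ('x, 'x) cmat. (\<forall>i j. i \<notin> X \<or> j \<notin> X \<longrightarrow> M i j = 0) \<and>
      (\<forall>\<phi>\<in>\<Phi>. \<forall>i\<in>X. \<forall>j\<in>X. M (\<phi> i) (\<phi> j) = M i j)}"
  have InvI: "M \<in> Inv" if "\<And>i j. i \<notin> X \<or> j \<notin> X \<Longrightarrow> M i j = 0"
    "\<And>\<phi> i j. \<phi> \<in> \<Phi> \<Longrightarrow> i \<in> X \<Longrightarrow> j \<in> X \<Longrightarrow> M (\<phi> i) (\<phi> j) = M i j" for M
    unfolding Inv_def using that by blast
  have Inv_supp: "M i j = 0" if "M \<in> Inv" "i \<notin> X \<or> j \<notin> X" for M i j
    using that unfolding Inv_def by blast
  have InvD: "M (\<phi> i) (\<phi> j) = M i j" if "M \<in> Inv" "\<phi> \<in> \<Phi>" "i \<in> X" "j \<in> X" for M \<phi> i j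
    using that unfolding Inv_def by blast
  have phiX: "\<phi> i \<in> X" if "\<phi> \<in> \<Phi>" "i \<in> X" for \<phi> i
    using bij[OF that(1)] that(2) by (auto simp: bij_betw_def)
  have span_eq: "mat_span \<A> = Inv"
  proof
    have "\<A> \<subseteq> Inv" by (intro subsetI, rule InvI) (use supp inv in blast)+
    moreover have "Modules.module.subspace (\<lambda>c A i j. c * A i j) Inv"
    proof (rule Modules.module.subspaceI[OF module_cmat])
      fix M N :: "('x, 'x) cmat" assume M: "M \<in> Inv" and N: "N \<in> Inv"
      show "M + N \<in> Inv"
        by (rule InvI) (use Inv_supp[OF M] Inv_supp[OF N] InvD[OF M] InvD[OF N] in \<open>simp_all only: plus_fun_apply add_0\<close>)
    next
      fix c :: complex and M :: "('x, 'x) cmat" assume M: "M \<in> Inv"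
      show "(\<lambda>i j. c * M i j) \<in> Inv"
        by (rule InvI) (use Inv_supp[OF M] InvD[OF M] in \<open>simp_all only: mult_zero_right\<close>)
    qed (rule InvI; simp)
    ultimately show "mat_span \<A> \<subseteq> Inv"
      unfolding mat_span_def by (rule Modules.module.span_minimal[OF module_cmat])
    show "Inv \<subseteq> mat_span \<A>"
    proof
      fix M assume M: "M \<in> Inv"
      \<comment> \<open>The coefficient of \<open>A\<close> is the entry of \<open>M\<close> at any
        position where \<open>A\<close> is 1; transitivity makes the choice immaterial. For a zero
        matrix the chosen position is arbitrary, but the coefficient then multiplies 0.\<close>
      define c where "c A = (case (SOME p. A (fst p) (snd p) = 1) of (i, j) \<Rightarrow> M i j)" for A :: "('x,'x) cmat"
      have c: "c A = M i j" if A: "A \<in> \<A>" and ij: "A i j = 1" for A i j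
      proof -
        obtain p where p: "p = (SOME p. A (fst p) (snd p) = 1)" by simp
        have Ap: "A (fst p) (snd p) = 1" unfolding p by (rule someI[of _ "(i,j)"]) (use ij in simp)
        have "i \<in> X" "j \<in> X" using supp[OF A, of i j] ij by force+
        obtain \<phi> where phi: "\<phi> \<in> \<Phi>" "\<phi> i = fst p" "\<phi> j = snd p" using trans[OF A ij Ap] by auto
        have "M (\<phi> i) (\<phi> j) = M i j"
          by (rule InvD[OF M phi(1) \<open>i \<in> X\<close> \<open>j \<in> X\<close>])
        then show ?thesis unfolding c_def using phi p by (auto simp: case_prod_beta)
      qed
      have "M = (\<Sum>A\<in>\<A>. (\<lambda>i j. c A * A i j))"
      proof (intro ext)
        fix i j
        show "M i j = (\<Sum>A\<in>\<A>. (\<lambda>i j. c A * A i j)) i j"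
        proof (cases "i \<in> X \<and> j \<in> X")
          case True
          then obtain A0 where A0: "A0 \<in> \<A>" "A0 i j = 1" and
            uniq: "\<And>A. A \<in> \<A> \<Longrightarrow> A i j = 1 \<Longrightarrow> A = A0"
          using part[of i j] unfolding Ex1_def by auto
          have e: "c A * A i j = (if A = A0 then M i j else 0)" if "A \<in> \<A>" for A
          proof (cases "A i j = 1")
            case True
            then show ?thesis using uniq[OF that True] c[OF A0] by simp
          next
            case False
            then show ?thesis using entries[OF that, of i j] A0(2) by auto
          qed
          have "(\<Sum>A\<in>\<A>. c A * A i j) = (\<Sum>A\<in>\<A>. if A = A0 then M i j else 0)"
            by (rule sum.cong[OF refl e])
          then show ?thesis using A0 finA by (simp add: sum_fun2_apply)
        next
          case False
          then show ?thesis using Inv_supp[OF M, of i j] supp[of _ i j]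
            by (auto simp: sum_fun2_apply intro!: sum.neutral)
        qed
      qed
      also have "\<dots> \<in> mat_span \<A>" unfolding mat_span_def
        by (rule Modules.module.span_sum[OF module_cmat],
            rule Modules.module.span_scale[OF module_cmat], rule Modules.module.span_base[OF module_cmat])
      finally show "M \<in> mat_span \<A>" .
    qed
  qed
  have mult: "mat_mult X M N \<in> Inv" if M: "M \<in> Inv" and N: "N \<in> Inv" for M N
  proof -
    have invar: "mat_mult X M N (\<phi> i) (\<phi> j) = mat_mult X M N i j"
      if "\<phi> \<in> \<Phi>" "i \<in> X" "j \<in> X" for \<phi> i j
    proof -
      have "(\<Sum>k\<in>X. M (\<phi> i) k * N k (\<phi> j)) = (\<Sum>k\<in>X. M (\<phi> i) (\<phi> k) * N (\<phi> k) (\<phi> j))"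
        by (rule sum.reindex_bij_betw[OF bij[OF that(1)], symmetric])
      also have "\<dots> = (\<Sum>k\<in>X. M i k * N k j)"
        by (rule sum.cong[OF refl]) (simp only: InvD[OF M that(1,2)] InvD[OF N that(1) _ that(3)])
      finally show ?thesis by (simp add: mat_mult_def)
    qed
    have supp0: "mat_mult X M N i j = 0" if "i \<notin> X \<or> j \<notin> X" for i j
      using that by (auto simp: mat_mult_def Inv_supp[OF M] Inv_supp[OF N])
    show ?thesis by (rule InvI) (fact supp0 invar)+
  qed
  have adj: "mat_adjoint M \<in> Inv" if "M \<in> Inv" for M
  proof (rule InvI)
    fix \<phi> i j assume "\<phi> \<in> \<Phi>" "i \<in> X" "j \<in> X"
    then show "mat_adjoint M (\<phi> i) (\<phi> j) = mat_adjoint M i j"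
      using InvD[OF that, of \<phi> j i] by (simp add: mat_adjoint_def)
  qed (use Inv_supp[OF that] in \<open>auto simp: mat_adjoint_def\<close>)
  have ones: "(\<Sum>A\<in>\<A>. A) = ones_mat X"
  proof (intro ext)
    fix i j
    show "(\<Sum>A\<in>\<A>. A) i j = ones_mat X i j"
    proof (cases "i \<in> X \<and> j \<in> X")
      case True
      then obtain A0 where A0: "A0 \<in> \<A>" "A0 i j = 1" and
        uniq: "\<And>A. A \<in> \<A> \<Longrightarrow> A i j = 1 \<Longrightarrow> A = A0"
          using part[of i j] unfolding Ex1_def by auto
      have e: "A i j = (if A = A0 then 1 else 0)" if "A \<in> \<A>" for A
      proof (cases "A i j = 1")
        case True
        then show ?thesis using uniq[OF that True] by simp
      next
        case False
        then show ?thesis using entries[OF that, of i j] A0(2) by auto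
      qed
      have "(\<Sum>A\<in>\<A>. A i j) = (\<Sum>A\<in>\<A>. if A = A0 then 1 else 0)"
        by (rule sum.cong[OF refl e])
      then show ?thesis using A0 finA True by (simp add: sum_fun2_apply ones_mat_def)
    next
      case False
      then show ?thesis using supp[of _ i j]
        by (auto simp: sum_fun2_apply ones_mat_def intro!: sum.neutral)
    qed
  qed
  show ?thesis
    unfolding association_scheme_def prod.case span_eq
    using finX finA entries supp id ones mult adj by auto
qed

section \<open>Reindexing of schemes along bijections\<close>

definition pullback :: "'y set \<Rightarrow> ('y \<Rightarrow> 'x) \<Rightarrow> ('x, 'x) cmat \<Rightarrow> ('y, 'y) cmat" where
  "pullback Y F A = (\<lambda>p q. if p \<in> Y \<and> q \<in> Y then A (F p) (F q) else 0)"

lemma pullback_apply: "p \<in> Y \<Longrightarrow> q \<in> Y \<Longrightarrow> pullback Y F A p q = A (F p) (F q)"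
  by (simp add: pullback_def)

lemma mat_span_pullback: "mat_span (pullback Y F ` \<A>) = pullback Y F ` mat_span \<A>"
  unfolding mat_span_def
  by (rule Modules.module_hom.span_image, unfold_locales)
    (auto simp: pullback_def fun_eq_iff algebra_simps)

text \<open>Bijectivity of \<open>F\<close> makes reindexing commute with products and adjoints, so
  all axioms transfer. Applied to the Schurian scheme it supplies the scheme, hence the algebra, of
  the roux under construction.\<close>

lemma association_scheme_pullback:
  assumes S: "association_scheme (X, \<A>)" and F: "bij_betw F Y X"
  shows "association_scheme (Y, pullback Y F ` \<A>)"
proof -
  have finX: "finite X" and finA: "finite \<A>"
    and entries: "\<And>A i j. A \<in> \<A> \<Longrightarrow> i \<in> X \<Longrightarrow> j \<in> X \<Longrightarrow> A i j = 0 \<or> A i j = 1"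
    and supp: "\<And>A i j. A \<in> \<A> \<Longrightarrow> i \<notin> X \<or> j \<notin> X \<Longrightarrow> A i j = 0"
    and id: "id_mat X \<in> \<A>" and ones: "(\<Sum>A\<in>\<A>. A) = ones_mat X"
    and mult: "\<And>A B. A \<in> mat_span \<A> \<Longrightarrow> B \<in> mat_span \<A> \<Longrightarrow> mat_mult X A B \<in> mat_span \<A>"
    and adj: "\<And>A. A \<in> mat_span \<A> \<Longrightarrow> mat_adjoint A \<in> mat_span \<A>"
    using S unfolding association_scheme_def by auto
  have FX: "F p \<in> X" if "p \<in> Y" for p using F that by (auto simp: bij_betw_def)
  have Finj: "F p = F q \<longleftrightarrow> p = q" if "p \<in> Y" "q \<in> Y" for p q
    using F that by (auto simp: bij_betw_def inj_on_def)
  have "finite Y" using F finX by (simp add: bij_betw_finite)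
  \<comment> \<open>The axiom on the all-ones matrix sums over a set, so distinct matrices must not
    merge under reindexing.\<close>
  have inj: "inj_on (pullback Y F) \<A>"
  proof (rule inj_onI, intro ext)
    fix A B i j assume A: "A \<in> \<A>" and B: "B \<in> \<A>" and eq: "pullback Y F A = pullback Y F B"
    show "A i j = B i j"
    proof (cases "i \<in> X \<and> j \<in> X")
      case True
      then obtain p q where "p \<in> Y" "q \<in> Y" "i = F p" "j = F q" using F by (auto simp: bij_betw_def)
      then show ?thesis using fun_cong[OF fun_cong[OF eq, of p], of q] by (simp add: pullback_def)
    next
      case False
      then show ?thesis using supp[OF A, of i j] supp[OF B, of i j] by auto
    qed
  qed
  have "id_mat Y = pullback Y F (id_mat X)"
    by (auto simp: pullback_def id_mat_def fun_eq_iff FX Finj)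
  moreover have "(\<Sum>A\<in>pullback Y F ` \<A>. A) = ones_mat Y"
  proof (intro ext)
    fix p q
    have "(\<Sum>A\<in>pullback Y F ` \<A>. A) p q = (\<Sum>A\<in>\<A>. pullback Y F A p q)"
      by (simp add: sum.reindex[OF inj] sum_fun2_apply)
    also have "\<dots> = (if p \<in> Y \<and> q \<in> Y then (\<Sum>A\<in>\<A>. A) (F p) (F q) else 0)"
      by (auto simp: pullback_def sum_fun2_apply intro!: sum.neutral)
    also have "\<dots> = ones_mat Y p q" by (auto simp: ones ones_mat_def FX)
    finally show "(\<Sum>A\<in>pullback Y F ` \<A>. A) p q = ones_mat Y p q" .
  qed
  moreover have "mat_mult Y (pullback Y F A) (pullback Y F B) = pullback Y F (mat_mult X A B)" for A B
    by (auto simp: mat_mult_def pullback_def fun_eq_iff sum.reindex_bij_betw[OF F, symmetric]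
        intro!: sum.cong sum.neutral)
  moreover have "mat_adjoint (pullback Y F A) = pullback Y F (mat_adjoint A)" for A
    by (auto simp: mat_adjoint_def pullback_def fun_eq_iff)
  moreover have "pullback Y F A p q = 0" if "p \<notin> Y \<or> q \<notin> Y" for A p q
    using that by (auto simp: pullback_def)
  moreover have "pullback Y F A p q \<in> {0, 1}" if "A \<in> \<A>" for A p q
    using that entries FX by (auto simp: pullback_def)
  ultimately show ?thesis
    unfolding association_scheme_def prod.case mat_span_pullback
    using \<open>finite Y\<close> finA id mult adj by auto
qed

text \<open>Row \<open>p\<close> of the permutation matrix has its only 1 in column
  \<open>F p\<close>. The left factor therefore selects a row and the adjoint on the right a column;
  conjugation leaves 0/1 entries alone.\<close>

lemma perm_mat_conj:
  assumes f: "bij_betw f X Y" and finX: "finite X" and F: "\<And>x. x \<in> X \<Longrightarrow> F (f x) = x"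
  shows "mat_mult X (mat_mult X (perm_mat X f) A) (mat_adjoint (perm_mat X f)) = pullback Y F A"
proof (intro ext)
  fix p q
  have row: "(\<Sum>k\<in>X. perm_mat X f p k * g k) = (if p \<in> Y then g (F p) else 0)" for g p
  proof (cases "p \<in> Y")
    case True
    then obtain x where x: "x \<in> X" "p = f x" using f by (auto simp: bij_betw_def)
    have "(\<Sum>k\<in>X. perm_mat X f p k * g k) = (\<Sum>k\<in>X. if k = x then g k else 0)"
      using f x by (intro sum.cong) (auto simp: perm_mat_def bij_betw_def inj_on_def)
    then show ?thesis using x finX True F by simp
  next
    case False
    then show ?thesis using f by (auto simp: perm_mat_def bij_betw_def intro!: sum.neutral)
  qed
  have "cnj (perm_mat X f q k) = perm_mat X f q k" for k by (simp add: perm_mat_def)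
  then have "mat_mult X (mat_mult X (perm_mat X f) A) (mat_adjoint (perm_mat X f)) p q
      = (\<Sum>k\<in>X. (if p \<in> Y then A (F p) k else 0) * perm_mat X f q k)"
    unfolding mat_mult_def mat_adjoint_def row by (intro sum.cong) simp_all
  also have "\<dots> = (\<Sum>k\<in>X. perm_mat X f q k * (if p \<in> Y then A (F p) k else 0))"
    by (simp only: mult.commute)
  finally show "mat_mult X (mat_mult X (perm_mat X f) A) (mat_adjoint (perm_mat X f)) p q
      = pullback Y F A p q"
    unfolding row by (auto simp: pullback_def)
qed

text \<open>The bijections \<open>f\<close> and \<open>F\<close> are inverse to each other. From
  here on isomorphism means equality of reindexed matrices, and no permutation matrix appears
  again.\<close>

lemma scheme_isomorphic_iff_pullback:
  "scheme_isomorphic (X, \<A>) (Y, \<B>) \<longleftrightarrow>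
     association_scheme (X, \<A>) \<and> association_scheme (Y, \<B>) \<and>
     (\<exists>F. bij_betw F Y X \<and> pullback Y F ` \<A> = \<B>)" (is "_ \<longleftrightarrow> ?a \<and> ?b \<and> ?F")
proof -
  have "(\<exists>f. bij_betw f X Y \<and>
        (\<lambda>A. mat_mult X (mat_mult X (perm_mat X f) A) (mat_adjoint (perm_mat X f))) ` \<A> = \<B>) \<longleftrightarrow> ?F"
    if fin: "finite X"
  proof safe
    fix f assume f: "bij_betw f X Y"
    have F: "inv_into X f (f x) = x" if "x \<in> X" for x
      using f that by (simp add: bij_betw_def)
    show "\<exists>F. bij_betw F Y X \<and> pullback Y F ` \<A>
      = (\<lambda>A. mat_mult X (mat_mult X (perm_mat X f) A) (mat_adjoint (perm_mat X f))) ` \<A>"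
      using bij_betw_inv_into[OF f] perm_mat_conj[OF f fin F] by auto
  next
    fix F assume F: "bij_betw F Y X"
    have f: "bij_betw (inv_into Y F) X Y" using F by (rule bij_betw_inv_into)
    have F': "F (inv_into Y F x) = x" if "x \<in> X" for x
      using F that by (simp add: bij_betw_inv_into_right)
    show "\<exists>f. bij_betw f X Y \<and>
      (\<lambda>A. mat_mult X (mat_mult X (perm_mat X f) A) (mat_adjoint (perm_mat X f))) ` \<A>
      = pullback Y F ` \<A>"
      using f perm_mat_conj[OF f fin F'] by (intro exI[of _ "inv_into Y F"]) simp
  qed
  moreover have "finite X" if ?a using that by (simp add: association_scheme_def)
  ultimately show ?thesis unfolding scheme_isomorphic_def by auto
qed

section \<open>The Cayley representation of roux matrices\<close>

lemma cayley_of: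
  assumes "finite (carrier \<Gamma>)" "x \<in> carrier \<Gamma>"
  shows "cayley \<Gamma> (gr_of x) g h =
    (if g \<in> carrier \<Gamma> \<and> h \<in> carrier \<Gamma> \<and> x \<otimes>\<^bsub>\<Gamma>\<^esub> h = g then 1 else 0)"
proof -
  have "(\<Sum>k\<in>carrier \<Gamma>. gr_of x k * (if k \<otimes>\<^bsub>\<Gamma>\<^esub> h = g then 1 else 0 :: complex))
      = (\<Sum>k\<in>carrier \<Gamma>. if k = x then (if x \<otimes>\<^bsub>\<Gamma>\<^esub> h = g then 1 else 0) else 0)"
    by (intro sum.cong) (auto simp: gr_of_def)
  also have "\<dots> = (if x \<otimes>\<^bsub>\<Gamma>\<^esub> h = g then 1 else 0)"
    using assms by simp
  finally show ?thesis by (simp add: cayley_def)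
qed

lemma cayley_zero [simp]: "cayley \<Gamma> 0 = 0"
  by (auto simp: cayley_def fun_eq_iff)

lemma gr_mult_zero [simp]: "gr_mult \<Gamma> x 0 = 0"
  by (auto simp: gr_mult_def fun_eq_iff)

lemma gr_mult_outside:
  assumes "group \<Gamma>" "g \<notin> carrier \<Gamma>"
  shows "gr_mult \<Gamma> x y g = 0"
proof -
  interpret group \<Gamma> by fact
  have none: "{(h, k). h \<in> carrier \<Gamma> \<and> k \<in> carrier \<Gamma> \<and> h \<otimes>\<^bsub>\<Gamma>\<^esub> k = g} = {}" using assms by auto
  show ?thesis unfolding gr_mult_def none by simp
qed

lemma gr_mult_eq:
  assumes "group \<Gamma>" "finite (carrier \<Gamma>)" "g \<in> carrier \<Gamma>"
  shows "gr_mult \<Gamma> x y g = (\<Sum>k\<in>carrier \<Gamma>. x (g \<otimes>\<^bsub>\<Gamma>\<^esub> inv\<^bsub>\<Gamma>\<^esub> k) * y k)"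
proof -
  interpret group \<Gamma> by fact
  have "(\<Sum>(h, k) | h \<in> carrier \<Gamma> \<and> k \<in> carrier \<Gamma> \<and> h \<otimes>\<^bsub>\<Gamma>\<^esub> k = g. x h * y k)
      = (\<Sum>k\<in>carrier \<Gamma>. x (g \<otimes>\<^bsub>\<Gamma>\<^esub> inv\<^bsub>\<Gamma>\<^esub> k) * y k)"
    by (rule sum.reindex_bij_witness[where i="\<lambda>k. (g \<otimes>\<^bsub>\<Gamma>\<^esub> inv\<^bsub>\<Gamma>\<^esub> k, k)" and j=snd])
      (use assms in \<open>auto simp: m_assoc\<close>)
  then show ?thesis by (simp add: gr_mult_def)
qed

lemma gr_mult_of:
  assumes "group \<Gamma>" "finite (carrier \<Gamma>)" "g \<in> carrier \<Gamma>" "h \<in> carrier \<Gamma>"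
  shows "gr_mult \<Gamma> (gr_of g) (gr_of h) = gr_of (g \<otimes>\<^bsub>\<Gamma>\<^esub> h)"
proof (rule ext)
  interpret group \<Gamma> by fact
  fix x
  show "gr_mult \<Gamma> (gr_of g) (gr_of h) x = gr_of (g \<otimes>\<^bsub>\<Gamma>\<^esub> h) x"
  proof (cases "x \<in> carrier \<Gamma>")
    case True
    have "gr_mult \<Gamma> (gr_of g) (gr_of h) x
        = (\<Sum>k\<in>carrier \<Gamma>. if k = h then gr_of g (x \<otimes>\<^bsub>\<Gamma>\<^esub> inv\<^bsub>\<Gamma>\<^esub> h) else 0)"
      unfolding gr_mult_eq[OF assms(1,2) True] by (intro sum.cong) (auto simp: gr_of_def)
    also have "\<dots> = gr_of g (x \<otimes>\<^bsub>\<Gamma>\<^esub> inv\<^bsub>\<Gamma>\<^esub> h)" using assms by simp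
    also have "\<dots> = gr_of (g \<otimes>\<^bsub>\<Gamma>\<^esub> h) x"
      using True assms by (auto simp: gr_of_def inv_solve_right m_assoc)
    finally show ?thesis .
  qed (use assms in \<open>auto simp: gr_mult_outside gr_of_def\<close>)
qed

text \<open>Only \<open>k = g h^(-1)\<close> satisfies \<open>k h = g\<close>, so entries of the
  regular representation are plain coefficients.\<close>

lemma cayley_eq:
  assumes "group \<Gamma>" "finite (carrier \<Gamma>)" "g \<in> carrier \<Gamma>" "h \<in> carrier \<Gamma>"
  shows "cayley \<Gamma> x g h = x (g \<otimes>\<^bsub>\<Gamma>\<^esub> inv\<^bsub>\<Gamma>\<^esub> h)"
proof -
  interpret group \<Gamma> by fact
  have "(\<Sum>k\<in>carrier \<Gamma>. x k * (if k \<otimes>\<^bsub>\<Gamma>\<^esub> h = g then 1 else 0))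
      = (\<Sum>k\<in>carrier \<Gamma>. if k = g \<otimes>\<^bsub>\<Gamma>\<^esub> inv\<^bsub>\<Gamma>\<^esub> h then x k else 0)"
    using assms by (intro sum.cong) (auto simp: inv_solve_right inv_solve_right')
  then show ?thesis using assms by (simp add: cayley_def)
qed

lemma cayley_mult:
  assumes "group \<Gamma>" "finite (carrier \<Gamma>)" "g \<in> carrier \<Gamma>" "h \<in> carrier \<Gamma>"
  shows "cayley \<Gamma> (gr_mult \<Gamma> x y) g h = (\<Sum>k\<in>carrier \<Gamma>. cayley \<Gamma> x g k * cayley \<Gamma> y k h)"
proof -
  interpret group \<Gamma> by fact
  have "cayley \<Gamma> (gr_mult \<Gamma> x y) g h
      = (\<Sum>k\<in>carrier \<Gamma>. x (g \<otimes>\<^bsub>\<Gamma>\<^esub> inv\<^bsub>\<Gamma>\<^esub> h \<otimes>\<^bsub>\<Gamma>\<^esub> inv\<^bsub>\<Gamma>\<^esub> k) * y k)"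
    using assms by (simp add: cayley_eq gr_mult_eq)
  \<comment> \<open>The substitution replaces \<open>k\<close> by \<open>k h\<close>; both sums run
    over the factorizations of \<open>g h^(-1)\<close>.\<close>
  also have "\<dots> = (\<Sum>k\<in>carrier \<Gamma>. x (g \<otimes>\<^bsub>\<Gamma>\<^esub> inv\<^bsub>\<Gamma>\<^esub> k) * y (k \<otimes>\<^bsub>\<Gamma>\<^esub> inv\<^bsub>\<Gamma>\<^esub> h))"
    by (rule sum.reindex_bij_witness[where i="\<lambda>k. k \<otimes>\<^bsub>\<Gamma>\<^esub> inv\<^bsub>\<Gamma>\<^esub> h" and j="\<lambda>k. k \<otimes>\<^bsub>\<Gamma>\<^esub> h"])
      (use assms in \<open>auto simp: m_assoc inv_mult_group\<close>)
  finally show ?thesis using assms by (simp add: cayley_eq)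
qed

lemma mat_span_grmat_lift: "mat_span (grmat_lift \<Gamma> ` \<M>) = grmat_lift \<Gamma> ` grmat_span \<M>"
  unfolding mat_span_def grmat_span_def
  by (rule Modules.module_hom.span_image, unfold_locales)
    (auto simp: grmat_lift_def cayley_def fun_eq_iff algebra_simps sum.distrib sum_distrib_left
      intro!: sum.cong)

lemma cayley_sum:
  "cayley \<Gamma> (\<Sum>k\<in>S. f k) g h = (\<Sum>k\<in>S. cayley \<Gamma> (f k) g h)"
proof (induction S rule: infinite_finite_induct)
  case (insert x F)
  then show ?case
    by (auto simp: cayley_def algebra_simps sum.distrib)
qed (auto simp: cayley_def)

text \<open>This is block multiplication: the sum over pairs splits into a sum over block indices
  and, by \<open>cayley_mult\<close>, a convolution inside each block. Off the carrier both sides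
  vanish by the default value of \<open>cayley\<close>.\<close>

lemma grmat_lift_mult:
  assumes "group \<Gamma>" "finite (carrier \<Gamma>)"
  shows "grmat_lift \<Gamma> (grmat_mult \<Gamma> n M N) =
    mat_mult ({..<n} \<times> carrier \<Gamma>) (grmat_lift \<Gamma> M) (grmat_lift \<Gamma> N)"
proof (intro ext)
  fix p q :: "nat \<times> 'a"
  obtain i g j h where p: "p = (i, g)" and q: "q = (j, h)" by fastforce
  show "grmat_lift \<Gamma> (grmat_mult \<Gamma> n M N) p q =
    mat_mult ({..<n} \<times> carrier \<Gamma>) (grmat_lift \<Gamma> M) (grmat_lift \<Gamma> N) p q"
  proof (cases "g \<in> carrier \<Gamma> \<and> h \<in> carrier \<Gamma>")
    case True
    then show ?thesis using assms
      by (simp add: p q mat_mult_def grmat_lift_def grmat_mult_def cayley_sum cayley_mult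
          sum.cartesian_product case_prod_beta)
  next
    case False
    then show ?thesis
      by (auto simp: p q mat_mult_def grmat_lift_def cayley_def intro!: sum.neutral)
  qed
qed

text \<open>The column of the identity element in each block lists the coefficients of the group
  ring entry.\<close>

lemma grmat_lift_inject:
  assumes "group \<Gamma>" "finite (carrier \<Gamma>)"
    and "\<And>i j g. g \<notin> carrier \<Gamma> \<Longrightarrow> M i j g = 0" "\<And>i j g. g \<notin> carrier \<Gamma> \<Longrightarrow> N i j g = 0"
    and eq: "grmat_lift \<Gamma> M = grmat_lift \<Gamma> N"
  shows "M = N"
proof (intro ext)
  interpret group \<Gamma> by fact
  fix i j g
  show "M i j g = N i j g"
  proof (cases "g \<in> carrier \<Gamma>")
    case True
    have "cayley \<Gamma> (M i j) g \<one>\<^bsub>\<Gamma>\<^esub> = cayley \<Gamma> (N i j) g \<one>\<^bsub>\<Gamma>\<^esub>"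
      using fun_cong[OF fun_cong[OF eq, of "(i, g)"], of "(j, \<one>\<^bsub>\<Gamma>\<^esub>)"] by (simp add: grmat_lift_def)
    then show ?thesis using True assms(1,2) by (simp add: cayley_eq)
  qed (use assms(3,4) in auto)
qed

text \<open>This yields (R4) without computing a product over the group ring: the lifted product
  lies in the lifted span, and faithfulness of the lift brings it back.\<close>

lemma grmat_span_mult_closed:
  assumes grp: "group \<Gamma>" and fin: "finite (carrier \<Gamma>)"
    and supp: "\<And>M i j g. M \<in> \<M> \<Longrightarrow> g \<notin> carrier \<Gamma> \<Longrightarrow> M i j g = 0"
    and S: "association_scheme ({..<n} \<times> carrier \<Gamma>, grmat_lift \<Gamma> ` \<M>)"
    and M: "M \<in> grmat_span \<M>" and N: "N \<in> grmat_span \<M>"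
  shows "grmat_mult \<Gamma> n M N \<in> grmat_span \<M>"
proof -
  \<comment> \<open>The lift forgets coefficients off the carrier, so faithfulness needs both the
    span and the product to be supported on it.\<close>
  have supp': "\<forall>i j g. g \<notin> carrier \<Gamma> \<longrightarrow> L i j g = 0" if "L \<in> grmat_span \<M>" for L
  proof -
    have "grmat_span \<M> \<subseteq> {L. \<forall>i j g. g \<notin> carrier \<Gamma> \<longrightarrow> L i j g = 0}"
      unfolding grmat_span_def by (rule Modules.module.span_minimal[OF module_grmat]) (use supp in \<open>auto simp: Modules.module.subspace_def[OF module_grmat]\<close>)
    then show ?thesis using that by blast
  qed
  have "grmat_lift \<Gamma> (grmat_mult \<Gamma> n M N) \<in> grmat_lift \<Gamma> ` grmat_span \<M>"
    unfolding grmat_lift_mult[OF grp fin] mat_span_grmat_lift[symmetric]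
    using S M N unfolding association_scheme_def by (auto simp: mat_span_grmat_lift)
  then obtain L where L: "L \<in> grmat_span \<M>"
    and eq: "grmat_lift \<Gamma> (grmat_mult \<Gamma> n M N) = grmat_lift \<Gamma> L" by blast
  have "grmat_mult \<Gamma> n M N i j g = 0" if "g \<notin> carrier \<Gamma>" for i j g
  proof -
    have "(\<Sum>k\<in>S. gr_mult \<Gamma> (M i k) (N k j)) g = 0" for S
      by (induction S rule: infinite_finite_induct) (use that grp in \<open>auto simp: gr_mult_outside\<close>)
    then show ?thesis by (simp add: grmat_mult_def)
  qed
  then have "grmat_mult \<Gamma> n M N = L"
    using grmat_lift_inject[OF grp fin _ _ eq] supp'[OF L] by blast
  then show ?thesis using L by simp
qed

section \<open>Roux written through their off-diagonal group elements\<close>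

definition phase_matrix :: "nat \<Rightarrow> (nat \<Rightarrow> nat \<Rightarrow> 'c) \<Rightarrow> 'c grmat" where
  "phase_matrix n \<beta> = (\<lambda>i j. if i < n \<and> j < n \<and> i \<noteq> j then gr_of (\<beta> i j) else 0)"

lemma lift_smult_id:
  assumes "group \<Gamma>" "finite (carrier \<Gamma>)" "g \<in> carrier \<Gamma>"
  shows "grmat_lift \<Gamma> (grmat_smult \<Gamma> g (grmat_id \<Gamma> n)) (i, h) (j, k) =
    (if i < n \<and> i = j \<and> h \<in> carrier \<Gamma> \<and> k \<in> carrier \<Gamma> \<and> h = g \<otimes>\<^bsub>\<Gamma>\<^esub> k then 1 else 0)"
proof -
  interpret group \<Gamma> by fact
  show ?thesis using assms
    by (auto simp: grmat_lift_def grmat_smult_def grmat_id_def gr_mult_of cayley_of)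
qed

lemma lift_smult_phase_matrix:
  assumes "group \<Gamma>" "finite (carrier \<Gamma>)" "g \<in> carrier \<Gamma>"
    and "\<And>i j. i < n \<Longrightarrow> j < n \<Longrightarrow> i \<noteq> j \<Longrightarrow> \<beta> i j \<in> carrier \<Gamma>"
  shows "grmat_lift \<Gamma> (grmat_smult \<Gamma> g (phase_matrix n \<beta>)) (i, h) (j, k) =
    (if i < n \<and> j < n \<and> i \<noteq> j \<and> h \<in> carrier \<Gamma> \<and> k \<in> carrier \<Gamma> \<and>
        h = g \<otimes>\<^bsub>\<Gamma>\<^esub> \<beta> i j \<otimes>\<^bsub>\<Gamma>\<^esub> k then 1 else 0)"
proof -
  interpret group \<Gamma> by fact
  show ?thesis using assms
    by (auto simp: grmat_lift_def grmat_smult_def phase_matrix_def gr_mult_of cayley_of)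
qed

lemma gr_of_inject: "gr_of g = gr_of h \<longleftrightarrow> g = h"
  unfolding gr_of_def by (metis zero_neq_one)

text \<open>The off-diagonal entries are indicators of group elements, and \<open>gr_of\<close> is
  injective, so (R3) becomes an identity in \<open>\<Gamma>\<close>. Values of
  \<open>\<beta>\<close> on the diagonal or out of range are irrelevant.\<close>

lemma roux_phase_matrixE:
  assumes "roux \<Gamma> n B"
  obtains \<beta> where "B = phase_matrix n \<beta>"
    "\<And>i j. i < n \<Longrightarrow> j < n \<Longrightarrow> i \<noteq> j \<Longrightarrow> \<beta> i j \<in> carrier \<Gamma>"
    "\<And>i j. i < n \<Longrightarrow> j < n \<Longrightarrow> i \<noteq> j \<Longrightarrow> \<beta> j i = inv\<^bsub>\<Gamma>\<^esub> (\<beta> i j)"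
proof -
  have out: "\<And>i j. i \<ge> n \<or> j \<ge> n \<Longrightarrow> B i j = 0" and diag: "\<And>i. i < n \<Longrightarrow> B i i = 0"
    and off: "\<And>i j. i < n \<Longrightarrow> j < n \<Longrightarrow> i \<noteq> j \<Longrightarrow> B i j \<in> gr_of ` carrier \<Gamma>"
    and inv: "\<And>i j g. i < n \<Longrightarrow> j < n \<Longrightarrow> i \<noteq> j \<Longrightarrow> g \<in> carrier \<Gamma> \<Longrightarrow> B i j = gr_of g \<Longrightarrow>
      B j i = gr_of (inv\<^bsub>\<Gamma>\<^esub> g)"
    using assms unfolding roux_def by blast+
  define \<beta> where "\<beta> i j = (SOME g. g \<in> carrier \<Gamma> \<and> B i j = gr_of g)" for i j
  have \<beta>: "\<beta> i j \<in> carrier \<Gamma> \<and> B i j = gr_of (\<beta> i j)" if "i < n" "j < n" "i \<noteq> j" for i j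
    unfolding \<beta>_def by (rule someI_ex) (use off[OF that] in auto)
  have "B = phase_matrix n \<beta>"
  proof (intro ext[of B] ext[of "B _"])
    fix i j
    show "B i j = phase_matrix n \<beta> i j"
    proof (cases "i < n \<and> j < n \<and> i \<noteq> j")
      case True
      then show ?thesis using \<beta>[of i j] by (simp add: phase_matrix_def)
    next
      case False
      then have "B i j = 0" using out[of i j] diag[of i] by (cases "i = j"; cases "i < n") auto
      then show ?thesis using False by (auto simp: phase_matrix_def)
    qed
  qed
  moreover have "\<beta> j i = inv\<^bsub>\<Gamma>\<^esub> (\<beta> i j)" if "i < n" "j < n" "i \<noteq> j" for i j
    using inv[OF that] \<beta>[OF that] \<beta>[OF that(2,1)] that by (auto simp: gr_of_inject)
  ultimately show ?thesis using that \<beta> by blast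
qed

text \<open>The scheme axioms of the lift take the place of (R4), which they imply by
  \<open>grmat_span_mult_closed\<close>.\<close>

lemma roux_phase_matrixI:
  assumes "comm_group \<Gamma>" and "finite (carrier \<Gamma>)"
    and \<beta>: "\<And>i j. i < n \<Longrightarrow> j < n \<Longrightarrow> i \<noteq> j \<Longrightarrow> \<beta> i j \<in> carrier \<Gamma>"
    and inv: "\<And>i j. i < n \<Longrightarrow> j < n \<Longrightarrow> i \<noteq> j \<Longrightarrow> \<beta> j i = inv\<^bsub>\<Gamma>\<^esub> (\<beta> i j)"
    and "association_scheme (roux_scheme \<Gamma> n (phase_matrix n \<beta>))"
  shows "roux \<Gamma> n (phase_matrix n \<beta>)"
proof -
  interpret comm_group \<Gamma> by fact
  have "group \<Gamma>" by (rule is_group)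
  have "M i j g = 0" if "M \<in> roux_gens \<Gamma> n (phase_matrix n \<beta>)" "g \<notin> carrier \<Gamma>" for M i j g
    using that \<open>group \<Gamma>\<close> by (auto simp: roux_gens_def grmat_smult_def gr_mult_outside)
  then have closed: "grmat_mult \<Gamma> n M N \<in> grmat_span (roux_gens \<Gamma> n (phase_matrix n \<beta>))"
    if "M \<in> grmat_span (roux_gens \<Gamma> n (phase_matrix n \<beta>))"
      "N \<in> grmat_span (roux_gens \<Gamma> n (phase_matrix n \<beta>))" for M N
    by (rule grmat_span_mult_closed[OF \<open>group \<Gamma>\<close> assms(2) _ _ that])
      (use assms(5) in \<open>auto simp: roux_scheme_def\<close>)
  have off: "phase_matrix n \<beta> i j = gr_of (\<beta> i j)" if "i < n" "j < n" "i \<noteq> j" for i j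
    using that by (simp add: phase_matrix_def)
  show ?thesis
    unfolding roux_def
  proof (intro conjI allI impI ballI closed)
    fix i j g
    assume ij: "i < n" "j < n" "i \<noteq> j"
    show "phase_matrix n \<beta> i j \<in> gr_of ` carrier \<Gamma>" using off[OF ij] \<beta>[OF ij] by auto
    assume "g \<in> carrier \<Gamma>" "phase_matrix n \<beta> i j = gr_of g"
    then show "phase_matrix n \<beta> j i = gr_of (inv\<^bsub>\<Gamma>\<^esub> g)"
      using off[OF ij] off[OF ij(2,1)] ij inv[OF ij] by (simp add: gr_of_inject)
  qed (use assms(1,2) in \<open>auto simp: phase_matrix_def\<close>)
qed

section \<open>Double cosets and the normalizer\<close>

locale finite_group_pair = group G for G (structure) +
  fixes H
  assumes finite_carrier: "finite (carrier G)" and subgroup_H: "subgroup H G"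
begin

abbreviation "K \<equiv> normalizer G H"
abbreviation "D a \<equiv> double_coset G H a"
abbreviation "adj a \<equiv> schurian_adj G H (D a)"

lemma H_carrier: "h \<in> H \<Longrightarrow> h \<in> carrier G"
  and H_mult: "h \<in> H \<Longrightarrow> k \<in> H \<Longrightarrow> h \<otimes> k \<in> H"
  and H_inv: "h \<in> H \<Longrightarrow> inv h \<in> H"
  and H_one: "\<one> \<in> H"
  using subgroup_H by (auto dest: subgroup.mem_carrier intro: subgroup.m_closed subgroup.m_inv_closed
      subgroup.one_closed)

lemma subgroup_K: "subgroup K G"
  using subgroup_H by (intro normalizer_imp_subgroup subgroup.subset)

lemma K_carrier: "a \<in> K \<Longrightarrow> a \<in> carrier G"
  and K_mult: "a \<in> K \<Longrightarrow> c \<in> K \<Longrightarrow> a \<otimes> c \<in> K"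
  and K_inv: "a \<in> K \<Longrightarrow> inv a \<in> K"
  and K_one: "\<one> \<in> K"
  using subgroup_K by (auto dest: subgroup.mem_carrier intro: subgroup.m_closed subgroup.m_inv_closed
      subgroup.one_closed)

lemma inv_mult_cancel: "x \<in> carrier G \<Longrightarrow> y \<in> carrier G \<Longrightarrow> inv x \<otimes> (x \<otimes> y) = y"
  and mult_inv_cancel: "x \<in> carrier G \<Longrightarrow> y \<in> carrier G \<Longrightarrow> x \<otimes> (inv x \<otimes> y) = y"
  by (simp_all add: m_assoc[symmetric])

text \<open>As rewrite rules these associate words to the right, expand inverses of products and
  cancel adjacent inverse letters.\<close>

lemmas group_word = m_assoc inv_mult_group inv_mult_cancel mult_inv_cancel

lemma normal_H: "normal H (G\<lparr>carrier := K\<rparr>)"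
  using subgroup_in_normalizer subgroup_H by blast

lemma H_K: "h \<in> H \<Longrightarrow> h \<in> K"
  using subgroup.subset[OF normal_imp_subgroup[OF normal_H]] by auto

lemma K_conj: "a \<in> K \<Longrightarrow> h \<in> H \<Longrightarrow> a \<otimes> h \<otimes> inv a \<in> H"
  using normal.inv_op_closed2[OF normal_H, of a h] subgroup_K by (simp add: m_inv_consistent)

lemma K_conj': "a \<in> K \<Longrightarrow> h \<in> H \<Longrightarrow> inv a \<otimes> h \<otimes> a \<in> H"
  using K_conj[OF K_inv, of a h] K_carrier by simp

text \<open>By finiteness one inclusion suffices: conjugation is an injective map of
  \<open>H\<close> into itself, hence onto.\<close>

lemma normalizerI:
  assumes a: "a \<in> carrier G" and conj: "\<And>h. h \<in> H \<Longrightarrow> inv a \<otimes> h \<otimes> a \<in> H"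
  shows "a \<in> K"
proof -
  have finH: "finite H" using finite_carrier H_carrier by (meson finite_subset subsetI)
  have inj: "inj_on (\<lambda>h. inv a \<otimes> h \<otimes> a) H"
    using a H_carrier by (intro inj_onI) (simp add: m_assoc)
  have "(\<lambda>h. inv a \<otimes> h \<otimes> a) ` H = H"
    using endo_inj_surj[OF finH _ inj] conj by blast
  then have eq: "k \<in> H \<longleftrightarrow> (\<exists>h\<in>H. k = inv a \<otimes> h \<otimes> a)" for k by blast
  have "a <# H #> inv a = H"
  proof (intro equalityI subsetI)
    fix x assume "x \<in> a <# H #> inv a"
    then obtain h where h: "h \<in> H" "x = a \<otimes> h \<otimes> inv a" by (auto simp: l_coset_def r_coset_def)
    then obtain k where "k \<in> H" "h = inv a \<otimes> k \<otimes> a" using eq by blast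
    then show "x \<in> H" using h a H_carrier by (simp add: group_word)
  next
    fix x assume x: "x \<in> H"
    then have "x = a \<otimes> (inv a \<otimes> x \<otimes> a) \<otimes> inv a" using a H_carrier by (simp add: group_word)
    then show "x \<in> a <# H #> inv a" using conj[OF x] by (auto simp: l_coset_def r_coset_def)
  qed
  then show ?thesis
    using a subgroup.subset[OF subgroup_H] by (simp add: normalizer_def stabilizer_def)
qed

lemma D_iff: "x \<in> D a \<longleftrightarrow> (\<exists>h\<in>H. \<exists>k\<in>H. x = h \<otimes> a \<otimes> k)"
  by (auto simp: double_coset_def r_coset_def set_mult_def)

lemma D_self: "a \<in> carrier G \<Longrightarrow> a \<in> D a"
  unfolding D_iff using H_one by (auto intro!: bexI[of _ \<one>])

lemma D_carrier: "a \<in> carrier G \<Longrightarrow> x \<in> D a \<Longrightarrow> x \<in> carrier G"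
  using H_carrier by (auto simp: D_iff)

lemma D_closed:
  assumes "x \<in> D a" "a \<in> carrier G" "h \<in> H" "k \<in> H"
  shows "h \<otimes> x \<otimes> k \<in> D a"
proof -
  obtain h' k' where "h' \<in> H" "k' \<in> H" "x = h' \<otimes> a \<otimes> k'" using assms by (auto simp: D_iff)
  then have "h \<otimes> x \<otimes> k = (h \<otimes> h') \<otimes> a \<otimes> (k' \<otimes> k)" using assms H_carrier by (simp add: m_assoc)
  then show ?thesis unfolding D_iff using assms \<open>h' \<in> H\<close> \<open>k' \<in> H\<close> H_mult by blast
qed

lemma D_closed_l: "x \<in> D a \<Longrightarrow> a \<in> carrier G \<Longrightarrow> h \<in> H \<Longrightarrow> h \<otimes> x \<in> D a"
  using D_closed[of x a h \<one>] H_one D_carrier H_carrier by simp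

lemma D_eq:
  assumes "x \<in> D a" and a: "a \<in> carrier G"
  shows "D x = D a"
proof
  show "D x \<subseteq> D a" using D_closed[OF assms] by (auto simp: D_iff[of _ x])
  obtain h k where hk: "h \<in> H" "k \<in> H" "x = h \<otimes> a \<otimes> k" using assms by (auto simp: D_iff)
  then have "a = inv h \<otimes> x \<otimes> inv k" using a H_carrier by (simp add: group_word)
  then have "a \<in> D x" unfolding D_iff using hk H_inv by blast
  then show "D a \<subseteq> D x" using D_closed[of a x] D_carrier[OF a assms(1)] by (auto simp: D_iff[of _ a])
qed

text \<open>Since \<open>a\<close> normalizes \<open>H\<close>, the double coset \<open>HaH\<close>
  is the single coset \<open>aH\<close>; this is why \<open>adj a\<close> is a permutation
  matrix.\<close>

lemma D_K_iff:
  assumes a: "a \<in> K" and x: "x \<in> carrier G"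
  shows "x \<in> D a \<longleftrightarrow> inv a \<otimes> x \<in> H"
proof
  assume "x \<in> D a"
  then obtain h k where hk: "h \<in> H" "k \<in> H" "x = h \<otimes> a \<otimes> k" by (auto simp: D_iff)
  then have "inv a \<otimes> x = (inv a \<otimes> h \<otimes> a) \<otimes> k" using K_carrier[OF a] H_carrier by (simp add: m_assoc)
  then show "inv a \<otimes> x \<in> H" using K_conj'[OF a hk(1)] hk(2) H_mult by simp
next
  assume "inv a \<otimes> x \<in> H"
  moreover have "x = \<one> \<otimes> a \<otimes> (inv a \<otimes> x)" using K_carrier[OF a] x by (simp add: group_word)
  ultimately show "x \<in> D a" unfolding D_iff using H_one by blast
qed

lemma coset_eq_iff:
  assumes "x \<in> carrier G" "y \<in> carrier G" and L: "subgroup L G"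
  shows "x <# L = y <# L \<longleftrightarrow> inv y \<otimes> x \<in> L"
proof
  assume "x <# L = y <# L"
  then have "x \<in> y <# L" using lcos_self[OF assms(1) L] by simp
  then show "inv y \<otimes> x \<in> L" using subgroup.lcos_module_imp[OF L is_group assms(2)] by simp
next
  assume "inv y \<otimes> x \<in> L"
  then have "x \<in> y <# L" using subgroup.lcos_module_rev[OF L is_group assms(2,1)] by simp
  then show "x <# L = y <# L" using l_repr_independence[OF _ assms(2) L] by simp
qed

section \<open>The Schurian scheme as an association scheme\<close>

lemma adj_eq:
  assumes x: "x \<in> carrier G" and y: "y \<in> carrier G" and a: "a \<in> carrier G"
  shows "adj a (x <# H) (y <# H) = (if inv y \<otimes> x \<in> D a then 1 else 0)"
proof -
  have "inv y \<otimes> x \<in> D a" if "x' \<in> carrier G" "y' \<in> carrier G" "x <# H = x' <# H" "y <# H = y' <# H"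
    "inv y' \<otimes> x' \<in> D a" for x' y'
  proof -
    have "inv x' \<otimes> x \<in> H" "inv y \<otimes> y' \<in> H"
      using that coset_eq_iff subgroup_H x y by blast+
    then have "(inv y \<otimes> y') \<otimes> (inv y' \<otimes> x') \<otimes> (inv x' \<otimes> x) \<in> D a"
      using D_closed that a by blast
    then show ?thesis using x y that by (simp add: group_word)
  qed
  then show ?thesis unfolding schurian_adj_def using x y by auto
qed

lemma adj_outside: "U \<notin> lcosets H \<or> V \<notin> lcosets H \<Longrightarrow> adj a U V = 0"
  unfolding schurian_adj_def LCOSETS_def by auto

lemma lcosetsE:
  assumes "U \<in> lcosets L" obtains x where "x \<in> carrier G" "U = x <# L"
  using assms by (auto simp: LCOSETS_def)

lemma lcosetsI: "x \<in> carrier G \<Longrightarrow> x <# L \<in> lcosets L"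
  by (auto simp: LCOSETS_def)

lemma l_coset_mult: "g \<in> carrier G \<Longrightarrow> x \<in> carrier G \<Longrightarrow> g <# (x <# H) = (g \<otimes> x) <# H"
  using subgroup.subset[OF subgroup_H] by (simp add: lcos_m_assoc)

text \<open>\<open>G\<close> acts transitively on each relation of the scheme, which holds because
  the pairs \<open>(xH, yH)\<close> with \<open>y^(-1) x\<close> in a fixed double coset form one
  orbit.\<close>

lemma D_transport:
  assumes "x \<in> carrier G" "y \<in> carrier G" "x' \<in> carrier G" "y' \<in> carrier G" "a \<in> carrier G"
    and "inv y \<otimes> x \<in> D a" "inv y' \<otimes> x' \<in> D a"
  shows "\<exists>g\<in>carrier G. inv x' \<otimes> (g \<otimes> x) \<in> H \<and> inv y' \<otimes> (g \<otimes> y) \<in> H"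
proof -
  obtain h k where hk: "h \<in> H" "k \<in> H" "inv y \<otimes> x = h \<otimes> a \<otimes> k" using assms(6) by (auto simp: D_iff)
  obtain h' k' where hk': "h' \<in> H" "k' \<in> H" "inv y' \<otimes> x' = h' \<otimes> a \<otimes> k'"
    using assms(7) by (auto simp: D_iff)
  note c = H_carrier[OF hk(1)] H_carrier[OF hk(2)] H_carrier[OF hk'(1)] H_carrier[OF hk'(2)] assms(1-5)
  have x: "x = y \<otimes> (h \<otimes> a \<otimes> k)" using c by (simp add: hk(3)[symmetric] group_word)
  have x': "x' = y' \<otimes> (h' \<otimes> a \<otimes> k')" using c by (simp add: hk'(3)[symmetric] group_word)
  \<comment> \<open>Chosen so that \<open>g y = y' h' h^(-1)\<close>, which lies in
    \<open>y' H\<close>; then \<open>g x = y' h' a k = x' k'^(-1) k\<close> lies in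
    \<open>x' H\<close>.\<close>
  define g where "g = y' \<otimes> h' \<otimes> inv h \<otimes> inv y"
  have "g \<in> carrier G" using c by (simp add: g_def)
  moreover have "inv y' \<otimes> (g \<otimes> y) = h' \<otimes> inv h" using c by (simp add: g_def group_word)
  moreover have "inv x' \<otimes> (g \<otimes> x) = inv k' \<otimes> k"
    unfolding x x' g_def using c(1-4) c(6,8,9) by (simp add: group_word)
  ultimately show ?thesis using hk hk' H_mult H_inv by metis
qed

text \<open>Left translations serve as the symmetries: they fix \<open>y^(-1) x\<close>, and by
  \<open>D_transport\<close> the relations are exactly their orbits on pairs.\<close>

lemma association_scheme_schurian: "association_scheme (schurian_scheme G H)"
  unfolding schurian_scheme_def
proof (rule association_schemeI_transitive[where \<Phi> = "(\<lambda>g U. g <# U) ` carrier G"])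
  show "finite (lcosets H)" using finite_carrier by (auto simp: LCOSETS_def)
  show "finite ((\<lambda>a. adj a) ` carrier G)" using finite_carrier by simp
  have "adj a U V \<in> {0, 1}" for a U V by (simp add: schurian_adj_def)
  then show "A U V \<in> {0, 1}" if "A \<in> adj ` carrier G" for A U V
    using that by blast
  show "A U V = 0" if "A \<in> adj ` carrier G" "U \<notin> lcosets H \<or> V \<notin> lcosets H" for A U V
    using that adj_outside by auto
  show "\<exists>!A. A \<in> adj ` carrier G \<and> A U V = 1" if "U \<in> lcosets H" "V \<in> lcosets H" for U V
  proof -
    obtain x y where xy: "x \<in> carrier G" "U = x <# H" "y \<in> carrier G" "V = y <# H"
      using \<open>U \<in> lcosets H\<close> \<open>V \<in> lcosets H\<close> lcosetsE by metis
    show ?thesis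
    proof (rule ex1I[of _ "adj (inv y \<otimes> x)"])
      show "adj (inv y \<otimes> x) \<in> adj ` carrier G \<and> adj (inv y \<otimes> x) U V = 1"
        using xy by (auto simp: adj_eq D_self)
      fix A assume "A \<in> adj ` carrier G \<and> A U V = 1"
      then obtain a where a: "a \<in> carrier G" "A = adj a" "adj a U V = 1" by auto
      then have "inv y \<otimes> x \<in> D a" using xy by (simp add: adj_eq split: if_splits)
      then show "A = adj (inv y \<otimes> x)" using a D_eq by simp
    qed
  qed
  have "id_mat (lcosets H) = adj \<one>"
  proof (intro ext)
    fix U V
    show "id_mat (lcosets H) U V = adj \<one> U V"
    proof (cases "U \<in> lcosets H \<and> V \<in> lcosets H")
      case True
      then obtain x y where xy: "x \<in> carrier G" "U = x <# H" "y \<in> carrier G" "V = y <# H"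
        using lcosetsE by metis
      then show ?thesis using True
        by (simp add: adj_eq D_K_iff[OF K_one] id_mat_def coset_eq_iff[OF _ _ subgroup_H])
    next
      case False
      then show ?thesis using adj_outside[of U V] by (auto simp: id_mat_def)
    qed
  qed
  then show "id_mat (lcosets H) \<in> adj ` carrier G" by simp
  show "bij_betw \<phi> (lcosets H) (lcosets H)" if phi: "\<phi> \<in> (\<lambda>g U. g <# U) ` carrier G" for \<phi>
  proof -
    obtain g where g: "g \<in> carrier G" "\<phi> = (\<lambda>U. g <# U)" using phi by auto
    show ?thesis unfolding g(2)
      by (rule bij_betw_byWitness[where f' = "\<lambda>U. inv g <# U"])
        (use g(1) in \<open>auto elim!: lcosetsE simp: l_coset_mult group_word intro!: lcosetsI\<close>)
  qed
  show "A (\<phi> U) (\<phi> V) = A U V"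
    if phi: "\<phi> \<in> (\<lambda>g U. g <# U) ` carrier G" and A: "A \<in> adj ` carrier G"
      and UV: "U \<in> lcosets H" "V \<in> lcosets H" for \<phi> A U V
  proof -
    obtain g where g: "g \<in> carrier G" "\<phi> = (\<lambda>U. g <# U)" using phi by auto
    obtain a where a: "a \<in> carrier G" "A = adj a" using A by auto
    obtain x y where xy: "x \<in> carrier G" "U = x <# H" "y \<in> carrier G" "V = y <# H"
      using UV lcosetsE by metis
    show ?thesis using g a xy by (simp add: l_coset_mult adj_eq group_word)
  qed
  show "\<exists>\<phi>\<in>(\<lambda>g U. g <# U) ` carrier G. \<phi> U = U' \<and> \<phi> V = V'"
    if A: "A \<in> adj ` carrier G" and 1: "A U V = 1" "A U' V' = 1" for A U V U' V'
  proof -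
    obtain a where a: "a \<in> carrier G" "A = adj a" using A by auto
    have "U \<in> lcosets H" "V \<in> lcosets H" "U' \<in> lcosets H" "V' \<in> lcosets H"
      using 1 adj_outside a by (metis zero_neq_one)+
    then obtain x y x' y' where xy: "x \<in> carrier G" "U = x <# H" "y \<in> carrier G" "V = y <# H"
      "x' \<in> carrier G" "U' = x' <# H" "y' \<in> carrier G" "V' = y' <# H"
      using lcosetsE by metis
    have "inv y \<otimes> x \<in> D a" "inv y' \<otimes> x' \<in> D a"
      using 1 a xy by (simp_all add: adj_eq split: if_splits)
    then obtain g where g: "g \<in> carrier G" "inv x' \<otimes> (g \<otimes> x) \<in> H" "inv y' \<otimes> (g \<otimes> y) \<in> H"
      using D_transport[of x y x' y' a] xy a by blast
    then have "g <# U = U'" "g <# V = V'"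
      using xy by (simp_all add: l_coset_mult coset_eq_iff[OF _ _ subgroup_H])
    then show ?thesis using g(1) by blast
  qed
qed

lemma comm_group_Mod_iff:
  "comm_group (G\<lparr>carrier := K\<rparr> Mod H) \<longleftrightarrow>
    (\<forall>a\<in>K. \<forall>c\<in>K. inv (c \<otimes> a) \<otimes> (a \<otimes> c) \<in> H)"
proof -
  interpret Q: group "G\<lparr>carrier := K\<rparr> Mod H"
    by (rule normal.factorgroup_is_group[OF normal_H])
  \<comment> \<open>The library's quotient consists of right cosets, the scheme of left cosets;
    inside \<open>K\<close> they agree.\<close>
  have eq: "H #>\<^bsub>G\<lparr>carrier := K\<rparr>\<^esub> x = x <# H" if "x \<in> K" for x
    using normal.coset_eq[OF normal_H] that by simp
  have mult: "(H #>\<^bsub>G\<lparr>carrier := K\<rparr>\<^esub> a) \<otimes>\<^bsub>G\<lparr>carrier := K\<rparr> Mod H\<^esub> (H #>\<^bsub>G\<lparr>carrier := K\<rparr>\<^esub> c) = (a \<otimes> c) <# H"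
    if "a \<in> K" "c \<in> K" for a c
    using normal.rcos_sum[OF normal_H, of a c] that eq[OF K_mult[OF that]] by simp
  have car: "carrier (G\<lparr>carrier := K\<rparr> Mod H) = (\<lambda>x. H #>\<^bsub>G\<lparr>carrier := K\<rparr>\<^esub> x) ` K"
    by (simp add: carrier_FactGroup)
  have "comm_group (G\<lparr>carrier := K\<rparr> Mod H) \<longleftrightarrow>
    (\<forall>a\<in>K. \<forall>c\<in>K. (a \<otimes> c) <# H = (c \<otimes> a) <# H)"
  proof (intro iffI ballI)
    fix a c assume "comm_group (G\<lparr>carrier := K\<rparr> Mod H)" and ac: "a \<in> K" "c \<in> K"
    then interpret C: comm_group "G\<lparr>carrier := K\<rparr> Mod H" by blast
    show "(a \<otimes> c) <# H = (c \<otimes> a) <# H"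
      unfolding mult[OF ac, symmetric] mult[OF ac(2,1), symmetric]
      by (rule C.m_comm) (use ac car in blast)+
  next
    assume comm: "\<forall>a\<in>K. \<forall>c\<in>K. (a \<otimes> c) <# H = (c \<otimes> a) <# H"
    show "comm_group (G\<lparr>carrier := K\<rparr> Mod H)"
    proof (rule Q.group_comm_groupI)
      fix U V assume "U \<in> carrier (G\<lparr>carrier := K\<rparr> Mod H)" "V \<in> carrier (G\<lparr>carrier := K\<rparr> Mod H)"
      then obtain a c where ac: "a \<in> K" "c \<in> K"
        and U: "U = H #>\<^bsub>G\<lparr>carrier := K\<rparr>\<^esub> a" and V: "V = H #>\<^bsub>G\<lparr>carrier := K\<rparr>\<^esub> c"
        unfolding car by blast
      show "U \<otimes>\<^bsub>G\<lparr>carrier := K\<rparr> Mod H\<^esub> V = V \<otimes>\<^bsub>G\<lparr>carrier := K\<rparr> Mod H\<^esub> U"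
        unfolding U V mult[OF ac] mult[OF ac(2,1)] using comm ac by blast
    qed
  qed
  also have "\<dots> \<longleftrightarrow> (\<forall>a\<in>K. \<forall>c\<in>K. inv (c \<otimes> a) \<otimes> (a \<otimes> c) \<in> H)"
    using coset_eq_iff[OF _ _ subgroup_H] K_carrier K_mult by simp
  finally show ?thesis .
qed

section \<open>From a roux scheme to a Higman pair\<close>

theorem roux_imp_higman_pair:
  assumes n: "3 \<le> n" and roux: "roux \<Gamma> n B"
    and iso: "scheme_isomorphic (schurian_scheme G H) (roux_scheme \<Gamma> n B)"
  shows "higman_pair G H"
proof -
  obtain \<beta> where B: "B = phase_matrix n \<beta>"
    and \<beta>: "\<And>i j. i < n \<Longrightarrow> j < n \<Longrightarrow> i \<noteq> j \<Longrightarrow> \<beta> i j \<in> carrier \<Gamma>"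
    and \<beta>_inv: "\<And>i j. i < n \<Longrightarrow> j < n \<Longrightarrow> i \<noteq> j \<Longrightarrow> \<beta> j i = inv\<^bsub>\<Gamma>\<^esub> (\<beta> i j)"
    by (rule roux_phase_matrixE[OF roux]) blast
  interpret \<Gamma>: comm_group \<Gamma> using roux by (simp add: roux_def)
  have fin: "finite (carrier \<Gamma>)" using roux by (simp add: roux_def)
  define Y where "Y = {..<n} \<times> carrier \<Gamma>"
  obtain F where F: "bij_betw F Y (lcosets H)"
    and img: "pullback Y F ` adj ` carrier G = grmat_lift \<Gamma> ` roux_gens \<Gamma> n B"
    using iso unfolding schurian_scheme_def roux_scheme_def scheme_isomorphic_iff_pullback Y_def by blast
  \<comment> \<open>The isomorphism gives each coset \<open>xH\<close> two coordinates, a block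
    index \<open>ix x\<close> and a phase \<open>ph x\<close> in \<open>\<Gamma>\<close>. The
    conditions on \<open>b\<close> then become short computations with phases.\<close>
  define ix where "ix x = fst (inv_into Y F (x <# H))" for x
  define ph where "ph x = snd (inv_into Y F (x <# H))" for x
  have inY: "(ix x, ph x) \<in> Y" and F_ix: "F (ix x, ph x) = x <# H" if "x \<in> carrier G" for x
    using F that lcosetsI[of x H] inv_into_into[of "x <# H" F Y] f_inv_into_f[of "x <# H" F Y]
    by (simp_all add: ix_def ph_def bij_betw_def)
  have ix: "ix x < n" and ph: "ph x \<in> carrier \<Gamma>" if "x \<in> carrier G" for x
    using inY[OF that] by (auto simp: Y_def)
  have point_eq: "ix x = ix y \<and> ph x = ph y \<longleftrightarrow> inv y \<otimes> x \<in> H"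
    if "x \<in> carrier G" "y \<in> carrier G" for x y
    using F_ix[OF that(1)] F_ix[OF that(2)] coset_eq_iff[OF that subgroup_H]
    by (metis ix_def ph_def)
  have point_ex: "\<exists>x\<in>carrier G. ix x = i \<and> ph x = g" if "i < n" "g \<in> carrier \<Gamma>" for i g
  proof -
    have Y: "(i, g) \<in> Y" using that by (simp add: Y_def)
    then have "F (i, g) \<in> lcosets H" using F by (auto simp: bij_betw_def)
    then obtain x where x: "x \<in> carrier G" "F (i, g) = x <# H" by (rule lcosetsE)
    then have "inv_into Y F (x <# H) = (i, g)" using F Y by (metis bij_betw_inv_into_left)
    then show ?thesis using x by (auto simp: ix_def ph_def intro!: bexI[of _ x])
  qed
  \<comment> \<open>\<open>P1 a g\<close> and \<open>P2 a g\<close> express in coordinates that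
    \<open>HaH\<close> corresponds to \<open>gI\<close> and to \<open>gB\<close>,
    respectively.\<close>
  define P1 where "P1 a g \<longleftrightarrow> (\<forall>x\<in>carrier G. \<forall>y\<in>carrier G.
      inv y \<otimes> x \<in> D a \<longleftrightarrow> ix x = ix y \<and> ph x = g \<otimes>\<^bsub>\<Gamma>\<^esub> ph y)" for a g
  define P2 where "P2 a g \<longleftrightarrow> (\<forall>x\<in>carrier G. \<forall>y\<in>carrier G.
      inv y \<otimes> x \<in> D a \<longleftrightarrow> ix x \<noteq> ix y \<and> ph x = g \<otimes>\<^bsub>\<Gamma>\<^esub> \<beta> (ix x) (ix y) \<otimes>\<^bsub>\<Gamma>\<^esub> ph y)" for a g
  have mem_iff: "inv y \<otimes> x \<in> D a \<longleftrightarrow> pullback Y F (adj a) (ix x, ph x) (ix y, ph y) = 1"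
    if "a \<in> carrier G" "x \<in> carrier G" "y \<in> carrier G" for a x y
    using that by (simp add: pullback_apply inY F_ix adj_eq)
  have P1I: "P1 a g" if "a \<in> carrier G" "g \<in> carrier \<Gamma>"
    "pullback Y F (adj a) = grmat_lift \<Gamma> (grmat_smult \<Gamma> g (grmat_id \<Gamma> n))" for a g
    unfolding P1_def using that ix ph
    by (simp add: mem_iff lift_smult_id[OF \<Gamma>.is_group fin])
  have P2I: "P2 a g" if "a \<in> carrier G" "g \<in> carrier \<Gamma>"
    "pullback Y F (adj a) = grmat_lift \<Gamma> (grmat_smult \<Gamma> g B)" for a g
    unfolding P2_def using that ix ph
    by (simp add: mem_iff B lift_smult_phase_matrix[OF \<Gamma>.is_group fin _ \<beta>])
  have P_ex: "(\<exists>g\<in>carrier \<Gamma>. P1 a g) \<or> (\<exists>g\<in>carrier \<Gamma>. P2 a g)" if "a \<in> carrier G" for a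
  proof -
    have "pullback Y F (adj a) \<in> grmat_lift \<Gamma> ` roux_gens \<Gamma> n B" using img that by blast
    then show ?thesis unfolding roux_gens_def using P1I[OF that] P2I[OF that] by blast
  qed
  have gen_ex: "\<exists>a\<in>carrier G. pullback Y F (adj a) = grmat_lift \<Gamma> M" if "M \<in> roux_gens \<Gamma> n B" for M
  proof -
    have "grmat_lift \<Gamma> M \<in> pullback Y F ` adj ` carrier G" unfolding img using that by blast
    then show ?thesis by auto
  qed
  have P1_ex: "\<exists>a\<in>carrier G. P1 a g" if "g \<in> carrier \<Gamma>" for g
    using gen_ex[of "grmat_smult \<Gamma> g (grmat_id \<Gamma> n)"] P1I that by (auto simp: roux_gens_def)
  have unit_B: "grmat_smult \<Gamma> \<one>\<^bsub>\<Gamma>\<^esub> B \<in> roux_gens \<Gamma> n B" by (auto simp: roux_gens_def)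
  obtain b where b: "b \<in> carrier G" and P2b: "P2 b \<one>\<^bsub>\<Gamma>\<^esub>"
    using gen_ex[OF unit_B] P2I by blast
  text \<open>The matrices \<open>gB\<close> have at least two nonzero entries in each column since \<open>n \<ge> 3\<close>,
    whereas the elements of \<open>K\<close> give permutation matrices.\<close>
  have not_K: "a \<notin> K" if P2: "P2 a g" and a: "a \<in> carrier G" and g: "g \<in> carrier \<Gamma>" for a g
  proof
    assume "a \<in> K"
    have "\<exists>i<n. i \<noteq> ix \<one> \<and> i \<noteq> j" for j
    proof -
      have "\<not> {..<3::nat} \<subseteq> {ix \<one>, j}"
        using card_mono[of "{ix \<one>, j}" "{..<3}"] card_insert_le_m1[of 2 "{j}" "ix \<one>"] by auto
      then obtain i where "i < 3" "i \<noteq> ix \<one>" "i \<noteq> j" by auto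
      then show ?thesis using n by (intro exI[of _ i]) simp
    qed
    then obtain i j where ij: "i < n" "j < n" "i \<noteq> ix \<one>" "j \<noteq> ix \<one>" "i \<noteq> j" by blast
    \<comment> \<open>Every block other than that of \<open>H\<close> itself meets
      \<open>HaH\<close>. If \<open>a\<close> were in \<open>K\<close>, all of \<open>HaH\<close>
      would be the one coset \<open>aH\<close>, which has a single block index.\<close>
    have "\<exists>x\<in>D a. ix x = k \<and> x \<in> carrier G" if k: "k < n" "k \<noteq> ix \<one>" for k
    proof -
      have "g \<otimes>\<^bsub>\<Gamma>\<^esub> \<beta> k (ix \<one>) \<otimes>\<^bsub>\<Gamma>\<^esub> ph \<one> \<in> carrier \<Gamma>"
        using g ph \<beta>[OF k(1) ix k(2)] by simp
      then obtain x where "x \<in> carrier G" "ix x = k" "ph x = g \<otimes>\<^bsub>\<Gamma>\<^esub> \<beta> k (ix \<one>) \<otimes>\<^bsub>\<Gamma>\<^esub> ph \<one>"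
        using point_ex[OF k(1)] by blast
      moreover from this have "inv \<one> \<otimes> x \<in> D a" using P2 k unfolding P2_def by blast
      ultimately show ?thesis by auto
    qed
    then obtain x y where x: "x \<in> D a" "ix x = i" "x \<in> carrier G"
      and y: "y \<in> D a" "ix y = j" "y \<in> carrier G" using ij by blast
    have "inv a \<otimes> x \<in> H" "inv a \<otimes> y \<in> H" using D_K_iff \<open>a \<in> K\<close> x y by auto
    then have "ix x = ix a" "ix y = ix a" using point_eq x y a by blast+
    then show False using x y ij by simp
  qed
  \<comment> \<open>For \<open>gI\<close> only one coset is related to \<open>H\<close>, namely the
    one with coordinates \<open>ix \<one>\<close> and \<open>g\<close> times
    \<open>ph \<one>\<close>. Both \<open>a\<close> and \<open>h a\<close> represent it, so
    \<open>a^(-1) h a\<close> is in \<open>H\<close>.\<close>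
  have in_K: "a \<in> K" if P1: "P1 a g" and a: "a \<in> carrier G" for a g
  proof (rule normalizerI[OF a])
    fix h assume h: "h \<in> H"
    have "inv \<one> \<otimes> a \<in> D a" "inv \<one> \<otimes> (h \<otimes> a) \<in> D a"
      using a h H_carrier by (simp_all add: D_self D_closed_l)
    then have "ix a = ix \<one> \<and> ph a = g \<otimes>\<^bsub>\<Gamma>\<^esub> ph \<one>" "ix (h \<otimes> a) = ix \<one> \<and> ph (h \<otimes> a) = g \<otimes>\<^bsub>\<Gamma>\<^esub> ph \<one>"
      using P1 a h H_carrier unfolding P1_def by blast+
    then have "inv a \<otimes> (h \<otimes> a) \<in> H" using point_eq[of "h \<otimes> a" a] a h H_carrier by simp
    then show "inv a \<otimes> h \<otimes> a \<in> H" using a h H_carrier by (simp add: m_assoc)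
  qed
  have K_P1: "\<exists>g\<in>carrier \<Gamma>. P1 a g" if "a \<in> K" for a
    using P_ex[OF K_carrier[OF that]] not_K that K_carrier by blast
  \<comment> \<open>Since \<open>x^(-1) (x a) = a\<close> lies in \<open>HaH\<close>, right
    multiplication by an element of \<open>K\<close> keeps the block and multiplies every phase by
    one fixed element of \<open>\<Gamma>\<close>.\<close>
  have shift: "\<exists>g\<in>carrier \<Gamma>. \<forall>x\<in>carrier G. ix (x \<otimes> a) = ix x \<and> ph (x \<otimes> a) = g \<otimes>\<^bsub>\<Gamma>\<^esub> ph x"
    if a: "a \<in> K" for a
  proof -
    obtain g where g: "g \<in> carrier \<Gamma>" "P1 a g" using K_P1[OF a] by blast
    have "ix (x \<otimes> a) = ix x \<and> ph (x \<otimes> a) = g \<otimes>\<^bsub>\<Gamma>\<^esub> ph x" if "x \<in> carrier G" for x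
    proof -
      have "inv x \<otimes> (x \<otimes> a) \<in> D a" using that K_carrier[OF a] by (simp add: group_word D_self)
      then show ?thesis using g(2) that K_carrier[OF a] unfolding P1_def by blast
    qed
    then show ?thesis using g(1) by blast
  qed
  have shift_ex: "\<exists>a\<in>K. \<forall>x\<in>carrier G. ix (x \<otimes> a) = ix x \<and> ph (x \<otimes> a) = g \<otimes>\<^bsub>\<Gamma>\<^esub> ph x"
    if g: "g \<in> carrier \<Gamma>" for g
  proof -
    obtain a where a: "a \<in> carrier G" "P1 a g" using P1_ex[OF g] by blast
    have "ix (x \<otimes> a) = ix x \<and> ph (x \<otimes> a) = g \<otimes>\<^bsub>\<Gamma>\<^esub> ph x" if "x \<in> carrier G" for x
    proof -
      have "inv x \<otimes> (x \<otimes> a) \<in> D a" using that a by (simp add: group_word D_self)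
      then show ?thesis using a that unfolding P1_def by blast
    qed
    then show ?thesis using in_K a by blast
  qed
  have Db: "inv y \<otimes> x \<in> D b \<longleftrightarrow> ix x \<noteq> ix y \<and> ph x = \<beta> (ix x) (ix y) \<otimes>\<^bsub>\<Gamma>\<^esub> ph y"
    if "x \<in> carrier G" "y \<in> carrier G" for x y
  proof (cases "ix x = ix y")
    case False
    then show ?thesis using P2b that \<beta>[OF ix[OF that(1)] ix[OF that(2)]] unfolding P2_def by simp
  qed (use P2b that in \<open>auto simp: P2_def\<close>)
  have b_K: "b \<notin> K" by (rule not_K[OF P2b b \<Gamma>.one_closed])
  have b_one: "ix b \<noteq> ix \<one>" "ph b = \<beta> (ix b) (ix \<one>) \<otimes>\<^bsub>\<Gamma>\<^esub> ph \<one>"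
    using Db[of b \<one>] b by (simp_all add: D_self)
  have H1: "doubly_transitive G (lcosets K) (l_coset G)"
  proof -
    \<comment> \<open>Changing \<open>x\<close> within \<open>xK\<close> changes its phase
      arbitrarily, so any two distinct cosets of \<open>K\<close> have representatives related by
      \<open>HbH\<close>. Transitivity on that one relation then gives double transitivity on
      \<open>G/K\<close>.\<close>
    have to_Db: "\<exists>a\<in>K. inv y \<otimes> (x \<otimes> a) \<in> D b"
      if xy: "x \<in> carrier G" "y \<in> carrier G" "x <# K \<noteq> y <# K" for x y
    proof -
      have ne: "ix x \<noteq> ix y"
      proof
        assume "ix x = ix y"
        \<comment> \<open>Points in the same block cannot be related by any \<open>gB\<close>, so
          the double coset of \<open>y^(-1) x\<close> belongs to some \<open>gI\<close> and hence to
          \<open>K\<close>.\<close>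
        have c: "inv y \<otimes> x \<in> carrier G" using xy by simp
        have "\<exists>g\<in>carrier \<Gamma>. P1 (inv y \<otimes> x) g"
        proof (rule ccontr)
          assume "\<not> ?thesis"
          then obtain g where "P2 (inv y \<otimes> x) g" using P_ex[OF c] by blast
          then show False using D_self[OF c] xy \<open>ix x = ix y\<close> unfolding P2_def by blast
        qed
        then have "inv y \<otimes> x \<in> K" using in_K c by blast
        then show False using xy coset_eq_iff[OF xy(1,2) subgroup_K] by simp
      qed
      define u where "u = \<beta> (ix x) (ix y) \<otimes>\<^bsub>\<Gamma>\<^esub> ph y"
      have u: "u \<in> carrier \<Gamma>" using \<beta>[OF ix ix ne] ph xy by (simp add: u_def)
      obtain a where a: "a \<in> K" "ix (x \<otimes> a) = ix x" "ph (x \<otimes> a) = u \<otimes>\<^bsub>\<Gamma>\<^esub> inv\<^bsub>\<Gamma>\<^esub> ph x \<otimes>\<^bsub>\<Gamma>\<^esub> ph x"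
        using shift_ex[of "u \<otimes>\<^bsub>\<Gamma>\<^esub> inv\<^bsub>\<Gamma>\<^esub> ph x"] u ph xy by auto
      then have "ph (x \<otimes> a) = u" using u ph xy by (simp add: \<Gamma>.m_assoc)
      then have "inv y \<otimes> (x \<otimes> a) \<in> D b"
        using a ne xy K_carrier by (simp add: Db u_def)
      then show ?thesis using a by blast
    qed
    show ?thesis unfolding doubly_transitive_def
    proof (intro ballI impI)
      fix U V U' V'
      assume UV: "U \<in> lcosets K" "V \<in> lcosets K" "U' \<in> lcosets K" "V' \<in> lcosets K" "U \<noteq> V" "U' \<noteq> V'"
      obtain x y where 1: "x \<in> carrier G" "U = x <# K" "y \<in> carrier G" "V = y <# K"
        using UV(1,2) by (elim lcosetsE)
      obtain x' y' where 2: "x' \<in> carrier G" "U' = x' <# K" "y' \<in> carrier G" "V' = y' <# K"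
        using UV(3,4) by (elim lcosetsE)
      note xy = 1 2
      obtain a a' where a: "a \<in> K" "inv y \<otimes> (x \<otimes> a) \<in> D b" "a' \<in> K" "inv y' \<otimes> (x' \<otimes> a') \<in> D b"
        using to_Db[of x y] to_Db[of x' y'] xy UV(5,6) by blast
      note ac = K_carrier[OF a(1)] K_carrier[OF a(3)]
      obtain g where g: "g \<in> carrier G" "inv (x' \<otimes> a') \<otimes> (g \<otimes> (x \<otimes> a)) \<in> H" "inv y' \<otimes> (g \<otimes> y) \<in> H"
        using D_transport[of "x \<otimes> a" y "x' \<otimes> a'" y' b] a xy ac b by auto
      \<comment> \<open>Undoing the corrections \<open>a\<close> and \<open>a'\<close> leaves the
        coset of \<open>K\<close> unchanged.\<close>
      have "inv x' \<otimes> (g \<otimes> x) = a' \<otimes> (inv (x' \<otimes> a') \<otimes> (g \<otimes> (x \<otimes> a))) \<otimes> inv a"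
        using xy ac g(1) by (simp add: group_word)
      then have "inv x' \<otimes> (g \<otimes> x) \<in> K" "inv y' \<otimes> (g \<otimes> y) \<in> K"
        using g a H_K K_mult K_inv by auto
      moreover have "g <# (z <# K) = (g \<otimes> z) <# K" if "z \<in> carrier G" for z
        using lcos_m_assoc[OF subgroup.subset[OF subgroup_K] g(1) that] .
      ultimately have "g <# U = U'" "g <# V = V'"
        using xy g(1) by (simp_all add: coset_eq_iff[OF _ _ subgroup_K])
      then show "\<exists>g\<in>carrier G. g <# U = U' \<and> g <# V = V'" using g(1) by blast
    qed
  qed
  have H2: "comm_group (G\<lparr>carrier := K\<rparr> Mod H)"
    unfolding comm_group_Mod_iff
  proof (intro ballI)
    fix a c assume a: "a \<in> K" and c: "c \<in> K"
    obtain g where g: "g \<in> carrier \<Gamma>"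
      "\<And>x. x \<in> carrier G \<Longrightarrow> ix (x \<otimes> a) = ix x \<and> ph (x \<otimes> a) = g \<otimes>\<^bsub>\<Gamma>\<^esub> ph x" using shift[OF a] by blast
    obtain k where k: "k \<in> carrier \<Gamma>"
      "\<And>x. x \<in> carrier G \<Longrightarrow> ix (x \<otimes> c) = ix x \<and> ph (x \<otimes> c) = k \<otimes>\<^bsub>\<Gamma>\<^esub> ph x" using shift[OF c] by blast
    \<comment> \<open>The cosets of \<open>a c\<close> and \<open>c a\<close> have equal coordinates
      because their phases differ from \<open>ph \<one>\<close> by \<open>g k\<close> and
      \<open>k g\<close>.\<close>
    have "ix a = ix \<one>" "ph a = g \<otimes>\<^bsub>\<Gamma>\<^esub> ph \<one>" "ix c = ix \<one>" "ph c = k \<otimes>\<^bsub>\<Gamma>\<^esub> ph \<one>"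
      using g(2)[of \<one>] k(2)[of \<one>] K_carrier a c by simp_all
    then have "ix (a \<otimes> c) = ix (c \<otimes> a)" "ph (a \<otimes> c) = ph (c \<otimes> a)"
      using g(1) k(1) g(2)[of c] k(2)[of a] ph[of \<one>] K_carrier a c by (simp_all add: \<Gamma>.m_ac)
    then show "inv (c \<otimes> a) \<otimes> (a \<otimes> c) \<in> H"
      using K_carrier a c by (simp add: point_eq[symmetric])
  qed
  \<comment> \<open>(R3) reverses the relation of \<open>b\<close> and \<open>\<one>\<close>: the
    transposed entry of \<open>B\<close> is the inverse one.\<close>
  have "inv b \<in> D b"
  proof -
    have "\<beta> (ix \<one>) (ix b) = inv\<^bsub>\<Gamma>\<^esub> \<beta> (ix b) (ix \<one>)"
      by (rule \<beta>_inv[OF ix ix b_one(1)]) (use b in simp_all)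
    then have "inv b \<otimes> \<one> \<in> D b"
      using Db[of \<one> b] b b_one \<beta>[OF ix ix b_one(1)] ph by (simp add: \<Gamma>.m_assoc[symmetric])
    then show ?thesis using b by simp
  qed
  then have H3: "D b = D (inv b)" using D_eq b by simp
  \<comment> \<open>The pair \<open>a b\<close>, \<open>a\<close> is related by \<open>HbH\<close>.
    Right multiplication by \<open>a^(-1)\<close> shifts both phases by the same \<open>g\<close>,
    which commutes with the entry of \<open>B\<close>, so the relation persists.\<close>
  have H4: "a \<otimes> b \<otimes> inv a \<in> D b" if a: "a \<in> K" for a
  proof -
    have ac: "a \<in> carrier G" "inv a \<in> carrier G" using K_carrier a by auto
    obtain g where g: "g \<in> carrier \<Gamma>"
      "\<And>x. x \<in> carrier G \<Longrightarrow> ix (x \<otimes> inv a) = ix x \<and> ph (x \<otimes> inv a) = g \<otimes>\<^bsub>\<Gamma>\<^esub> ph x"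
      using shift[OF K_inv[OF a]] by blast
    have "inv a \<otimes> (a \<otimes> b) \<in> D b" using ac b by (simp add: group_word D_self)
    then have *: "ix (a \<otimes> b) \<noteq> ix a" "ph (a \<otimes> b) = \<beta> (ix (a \<otimes> b)) (ix a) \<otimes>\<^bsub>\<Gamma>\<^esub> ph a"
      using Db[of "a \<otimes> b" a] ac b by auto
    have "\<beta> (ix (a \<otimes> b)) (ix a) \<in> carrier \<Gamma>" using \<beta> ix * ac b by simp
    then have "g \<otimes>\<^bsub>\<Gamma>\<^esub> ph (a \<otimes> b) = \<beta> (ix (a \<otimes> b)) (ix a) \<otimes>\<^bsub>\<Gamma>\<^esub> (g \<otimes>\<^bsub>\<Gamma>\<^esub> ph a)"
      unfolding *(2) using g ph ac by (simp add: \<Gamma>.m_ac)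
    then have "inv (a \<otimes> inv a) \<otimes> (a \<otimes> b \<otimes> inv a) \<in> D b"
      using g(2)[of "a \<otimes> b"] g(2)[of a] * Db[of "a \<otimes> b \<otimes> inv a" "a \<otimes> inv a"] ac b by (simp del: r_inv)
    then show ?thesis using ac b by simp
  qed
  \<comment> \<open>Here \<open>a b\<close> is \<open>HbH\<close>-related to both \<open>a\<close>
    and \<open>\<one>\<close>, which lie in the same block. Cancelling the common entry of
    \<open>B\<close> gives \<open>ph a = ph \<one>\<close>, so \<open>a\<close> and
    \<open>\<one>\<close> represent the same coset of \<open>H\<close>.\<close>
  have H5: "a \<in> H" if a: "a \<in> K" and ab: "a \<otimes> b \<in> D b" for a
  proof -
    have ac: "a \<in> carrier G" using K_carrier a by auto
    obtain g where g: "g \<in> carrier \<Gamma>"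
      "\<And>x. x \<in> carrier G \<Longrightarrow> ix (x \<otimes> a) = ix x \<and> ph (x \<otimes> a) = g \<otimes>\<^bsub>\<Gamma>\<^esub> ph x"
      using shift[OF a] by blast
    have ixa: "ix a = ix \<one>" using g(2)[of \<one>] ac by simp
    have "inv a \<otimes> (a \<otimes> b) \<in> D b" using ac b by (simp add: group_word D_self)
    then have *: "ix (a \<otimes> b) \<noteq> ix \<one>" "ph (a \<otimes> b) = \<beta> (ix (a \<otimes> b)) (ix \<one>) \<otimes>\<^bsub>\<Gamma>\<^esub> ph a"
      using Db[of "a \<otimes> b" a] ac b ixa by auto
    have "ph (a \<otimes> b) = \<beta> (ix (a \<otimes> b)) (ix \<one>) \<otimes>\<^bsub>\<Gamma>\<^esub> ph \<one>"
      using ab Db[of "a \<otimes> b" \<one>] ac b by simp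
    then have "ph a = ph \<one>" using * \<beta>[OF ix ix *(1)] ph ac b by simp
    then show ?thesis using point_eq[of a \<one>] ixa ac by simp
  qed
  show ?thesis
    unfolding higman_pair_def Let_def
    using finite_carrier subgroup_H is_group b b_K H_K H1 H2 H3 H4 H5 by blast
qed

section \<open>From a Higman pair to a roux\<close>

lemma nat_quotient_group:
  assumes comm: "comm_group (G\<lparr>carrier := K\<rparr> Mod H)"
  obtains \<Gamma> :: "nat monoid" and \<kappa> where "comm_group \<Gamma>" "finite (carrier \<Gamma>)"
    "\<kappa> ` K = carrier \<Gamma>"
    "\<And>a c. a \<in> K \<Longrightarrow> c \<in> K \<Longrightarrow> \<kappa> (a \<otimes> c) = \<kappa> a \<otimes>\<^bsub>\<Gamma>\<^esub> \<kappa> c"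
    "\<And>a. a \<in> K \<Longrightarrow> \<kappa> (inv a) = inv\<^bsub>\<Gamma>\<^esub> \<kappa> a"
    "\<And>a c. a \<in> K \<Longrightarrow> c \<in> K \<Longrightarrow> \<kappa> a = \<kappa> c \<longleftrightarrow> inv c \<otimes> a \<in> H"
proof -
  define Q where "Q = G\<lparr>carrier := K\<rparr> Mod H"
  interpret Q: comm_group Q unfolding Q_def by (rule comm)
  have eq: "H #>\<^bsub>G\<lparr>carrier := K\<rparr>\<^esub> x = x <# H" if "x \<in> K" for x
    using normal.coset_eq[OF normal_H] that by simp
  have car: "carrier Q = (\<lambda>x. x <# H) ` K"
    unfolding Q_def carrier_FactGroup using eq by (auto simp: image_def)
  have mult: "(a <# H) \<otimes>\<^bsub>Q\<^esub> (c <# H) = (a \<otimes> c) <# H" if "a \<in> K" "c \<in> K" for a c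
    using normal.rcos_sum[OF normal_H, of a c] that eq[OF that(1)] eq[OF that(2)] eq[OF K_mult[OF that]]
    by (simp add: Q_def)
  have "finite K" using finite_carrier K_carrier by (meson finite_subset subsetI)
  then have finQ: "finite (carrier Q)" by (simp add: car)
  \<comment> \<open>Elements of the quotient are sets; numbering them carries the group structure
    over to \<open>nat\<close>, and \<open>\<kappa>\<close> is the quotient map in this
    copy.\<close>
  obtain e :: "'a set \<Rightarrow> nat" where e: "inj_on e (carrier Q)"
    using finite_imp_inj_to_nat_seg[OF finQ] by blast
  define \<Gamma> where "\<Gamma> = image_group e Q"
  define \<kappa> where "\<kappa> a = e (a <# H)" for a
  have iso: "e \<in> iso Q \<Gamma>" unfolding \<Gamma>_def by (rule inj_imp_image_group_iso[OF e])
  have "group \<Gamma>" unfolding \<Gamma>_def by (rule Q.inj_imp_image_group_is_group[OF e])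
  then have comm\<Gamma>: "comm_group \<Gamma>"
    using Q.iso_imp_comm_group[OF is_isoI[OF iso]] group.is_monoid by blast
  interpret \<Gamma>: comm_group \<Gamma> by (rule comm\<Gamma>)
  have im: "\<kappa> ` K = carrier \<Gamma>"
    by (simp add: \<Gamma>_def image_group_carrier car image_image \<kappa>_def)
  have hom: "\<kappa> (a \<otimes> c) = \<kappa> a \<otimes>\<^bsub>\<Gamma>\<^esub> \<kappa> c" if "a \<in> K" "c \<in> K" for a c
  proof -
    have "a <# H \<in> carrier Q" "c <# H \<in> carrier Q" using that by (auto simp: car)
    then have "e ((a <# H) \<otimes>\<^bsub>Q\<^esub> (c <# H)) = e (a <# H) \<otimes>\<^bsub>\<Gamma>\<^esub> e (c <# H)"
      using iso by (auto simp: iso_def intro: hom_mult)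
    then show ?thesis by (simp add: \<kappa>_def mult[OF that])
  qed
  have kc: "\<kappa> a \<in> carrier \<Gamma>" if "a \<in> K" for a using im that by blast
  have "\<kappa> \<one> \<otimes>\<^bsub>\<Gamma>\<^esub> \<kappa> \<one> = \<kappa> \<one>" using hom[OF K_one K_one] by simp
  then have one: "\<kappa> \<one> = \<one>\<^bsub>\<Gamma>\<^esub>" using kc[OF K_one] by simp
  have inv: "\<kappa> (inv a) = inv\<^bsub>\<Gamma>\<^esub> \<kappa> a" if "a \<in> K" for a
  proof -
    have "\<kappa> (inv a) \<otimes>\<^bsub>\<Gamma>\<^esub> \<kappa> a = \<one>\<^bsub>\<Gamma>\<^esub>"
      using hom[OF K_inv[OF that] that] one K_carrier[OF that] by simp
    then show ?thesis using \<Gamma>.inv_equality[OF _ kc[OF that] kc[OF K_inv[OF that]]] by simp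
  qed
  have ker: "\<kappa> a = \<kappa> c \<longleftrightarrow> inv c \<otimes> a \<in> H" if "a \<in> K" "c \<in> K" for a c
  proof -
    have "a <# H \<in> carrier Q" "c <# H \<in> carrier Q" using that by (auto simp: car)
    then have "\<kappa> a = \<kappa> c \<longleftrightarrow> a <# H = c <# H" unfolding \<kappa>_def using e by (simp add: inj_on_eq_iff)
    then show ?thesis using coset_eq_iff[OF _ _ subgroup_H] that K_carrier by simp
  qed
  have "finite (carrier \<Gamma>)" using \<open>finite K\<close> im by (metis finite_imageI)
  then show ?thesis using that comm\<Gamma> im hom inv ker by blast
qed

text \<open>Roles of the conditions: (H1) makes the sets \<open>HabH\<close> with \<open>a\<close>
  in \<open>K\<close> cover the complement of \<open>K\<close>, (H5) makes \<open>a\<close> unique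
  modulo \<open>H\<close>, (H4) lets elements of \<open>K\<close> pass across \<open>b\<close>, (H3)
  turns inversion of \<open>x\<close> into inversion of its class, and (H2) makes
  \<open>\<Gamma>\<close> abelian.\<close>

theorem higman_pair_imp_roux:
  assumes "higman_pair G H"
  shows "\<exists>(\<Gamma> :: nat monoid) n B. n \<ge> 3 \<and> roux \<Gamma> n B \<and>
    scheme_isomorphic (schurian_scheme G H) (roux_scheme \<Gamma> n B)"
proof -
  obtain b where b: "b \<in> carrier G" "b \<notin> K"
    and H1: "doubly_transitive G (lcosets K) (l_coset G)"
    and H2: "comm_group (G\<lparr>carrier := K\<rparr> Mod H)"
    and H3: "D b = D (inv b)"
    and H4: "\<And>a. a \<in> K \<Longrightarrow> a \<otimes> b \<otimes> inv a \<in> D b"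
    and H5: "\<And>a. a \<in> K \<Longrightarrow> a \<otimes> b \<in> D b \<Longrightarrow> a \<in> H"
    using assms unfolding higman_pair_def Let_def by blast
  obtain \<Gamma> :: "nat monoid" and \<kappa> where comm: "comm_group \<Gamma>" and fin: "finite (carrier \<Gamma>)"
    and \<kappa>_im: "\<kappa> ` K = carrier \<Gamma>"
    and \<kappa>_mult: "\<And>a c. a \<in> K \<Longrightarrow> c \<in> K \<Longrightarrow> \<kappa> (a \<otimes> c) = \<kappa> a \<otimes>\<^bsub>\<Gamma>\<^esub> \<kappa> c"
    and \<kappa>_inv: "\<And>a. a \<in> K \<Longrightarrow> \<kappa> (inv a) = inv\<^bsub>\<Gamma>\<^esub> \<kappa> a"
    and \<kappa>_eq: "\<And>a c. a \<in> K \<Longrightarrow> c \<in> K \<Longrightarrow> \<kappa> a = \<kappa> c \<longleftrightarrow> inv c \<otimes> a \<in> H"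
    by (rule nat_quotient_group[OF H2]) blast
  interpret \<Gamma>: comm_group \<Gamma> by (rule comm)
  have \<kappa>: "\<kappa> a \<in> carrier \<Gamma>" if "a \<in> K" for a using \<kappa>_im that by blast
  have abG: "a \<otimes> b \<in> carrier G" if "a \<in> K" for a using that b K_carrier by simp
  \<comment> \<open>Write \<open>b c = c (c^(-1) b c)\<close>. By (H4) the bracket lies in
    \<open>HbH\<close>, and the stray elements of \<open>H\<close> are pushed outwards past
    \<open>K\<close>, which normalizes \<open>H\<close>.\<close>
  have Dab_mult_r: "x \<otimes> c \<in> D (a \<otimes> c \<otimes> b)"
    if x: "x \<in> D (a \<otimes> b)" and a: "a \<in> K" and c: "c \<in> K" for x a c
  proof -
    obtain h k where hk: "h \<in> H" "k \<in> H" "x = h \<otimes> (a \<otimes> b) \<otimes> k" using x by (auto simp: D_iff)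
    have "inv c \<otimes> b \<otimes> c \<in> D b" using H4[OF K_inv[OF c]] K_carrier[OF c] by simp
    then obtain h' k' where hk': "h' \<in> H" "k' \<in> H" "inv c \<otimes> b \<otimes> c = h' \<otimes> b \<otimes> k'" by (auto simp: D_iff)
    note car = H_carrier[OF hk(1)] H_carrier[OF hk(2)] H_carrier[OF hk'(1)] H_carrier[OF hk'(2)]
      K_carrier[OF a] K_carrier[OF c] b(1)
    have "b \<otimes> c = c \<otimes> (inv c \<otimes> b \<otimes> c)" using car by (simp add: group_word)
    then have bc: "b \<otimes> c = c \<otimes> (h' \<otimes> b \<otimes> k')" by (simp only: hk'(3))
    have "x \<otimes> c = h \<otimes> a \<otimes> (b \<otimes> c) \<otimes> (inv c \<otimes> k \<otimes> c)" using car by (simp add: hk(3) group_word)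
    also have "\<dots> = (h \<otimes> ((a \<otimes> c) \<otimes> h' \<otimes> inv (a \<otimes> c))) \<otimes> (a \<otimes> c \<otimes> b) \<otimes> (k' \<otimes> (inv c \<otimes> k \<otimes> c))"
      unfolding bc using car by (simp add: group_word)
    finally show ?thesis
      unfolding D_iff using H_mult hk hk' K_conj[OF K_mult[OF a c]] K_conj'[OF c] by blast
  qed
  have Dab_mult_l: "c \<otimes> x \<in> D (c \<otimes> a \<otimes> b)"
    if x: "x \<in> D (a \<otimes> b)" and a: "a \<in> K" and c: "c \<in> K" for x a c
  proof -
    obtain h k where hk: "h \<in> H" "k \<in> H" "x = h \<otimes> (a \<otimes> b) \<otimes> k" using x by (auto simp: D_iff)
    have "c \<otimes> x = (c \<otimes> h \<otimes> inv c) \<otimes> (c \<otimes> a \<otimes> b) \<otimes> k"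
      using hk H_carrier K_carrier a c b by (simp add: group_word)
    then show ?thesis unfolding D_iff using K_conj[OF c hk(1)] hk by blast
  qed
  \<comment> \<open>(H3) puts \<open>b^(-1)\<close> in \<open>HbH\<close>, and
    \<open>Dab_mult_r\<close> moves the remaining factor \<open>a^(-1)\<close> to the left of
    \<open>b\<close>.\<close>
  have Dab_inv: "inv x \<in> D (inv a \<otimes> b)" if x: "x \<in> D (a \<otimes> b)" and a: "a \<in> K" for x a
  proof -
    obtain h k where hk: "h \<in> H" "k \<in> H" "x = h \<otimes> (a \<otimes> b) \<otimes> k" using x by (auto simp: D_iff)
    have "inv b \<in> D (\<one> \<otimes> b)" using H3 D_self[of "inv b"] b by simp
    then have "inv b \<otimes> inv a \<in> D (inv a \<otimes> b)"
      using Dab_mult_r[OF _ K_one K_inv[OF a]] K_carrier[OF a] by simp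
    then have "inv k \<otimes> (inv b \<otimes> inv a) \<otimes> inv h \<in> D (inv a \<otimes> b)"
      using D_closed hk H_inv abG[OF K_inv[OF a]] by blast
    then show ?thesis using hk H_carrier K_carrier[OF a] b by (simp add: group_word)
  qed
  have Dab_notK: "x \<notin> K" if x: "x \<in> D (a \<otimes> b)" and a: "a \<in> K" for x a
  proof
    assume xK: "x \<in> K"
    obtain h k where hk: "h \<in> H" "k \<in> H" "x = h \<otimes> (a \<otimes> b) \<otimes> k" using x by (auto simp: D_iff)
    have "b = inv a \<otimes> (inv h \<otimes> x \<otimes> inv k)"
      using hk H_carrier K_carrier[OF a] b by (simp add: group_word)
    also have "\<dots> \<in> K" using hk a xK H_K K_mult K_inv by simp
    finally show False using b by simp
  qed
  have Dab_eq: "D (a \<otimes> b) = D (c \<otimes> b)" if a: "a \<in> K" and c: "c \<in> K" and eq: "\<kappa> a = \<kappa> c" for a c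
  proof -
    have ac: "a \<in> carrier G" "c \<in> carrier G" using K_carrier a c by auto
    have h: "c \<otimes> (inv c \<otimes> a) \<otimes> inv c \<in> H" using \<kappa>_eq[OF a c] eq K_conj[OF c] by blast
    have "a \<otimes> b = (c \<otimes> (inv c \<otimes> a) \<otimes> inv c) \<otimes> (c \<otimes> b)" using ac b by (simp add: group_word)
    then have "a \<otimes> b \<in> D (c \<otimes> b)" using D_closed_l[OF D_self[OF abG[OF c]] abG[OF c] h] by simp
    then show ?thesis by (rule D_eq[OF _ abG[OF c]])
  qed
  have Dab_disj: "\<kappa> a = \<kappa> c" if x: "x \<in> D (a \<otimes> b)" "x \<in> D (c \<otimes> b)" and a: "a \<in> K" and c: "c \<in> K" for x a c
  proof -
    have "a \<otimes> b \<in> D (c \<otimes> b)" using x D_eq[OF x(1) abG[OF a]] D_eq[OF x(2) abG[OF c]] D_self[OF abG[OF a]] by simp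
    then have "inv c \<otimes> (a \<otimes> b) \<in> D (inv c \<otimes> c \<otimes> b)" by (rule Dab_mult_l) (use c K_inv in auto)
    then have "inv c \<otimes> a \<otimes> b \<in> D b" using K_carrier a c b by (simp add: m_assoc)
    then have "inv c \<otimes> a \<in> H" using H5 K_mult K_inv a c by blast
    then show ?thesis using \<kappa>_eq a c by blast
  qed
  \<comment> \<open>Double transitivity provides \<open>g\<close> fixing the coset \<open>K\<close>
    and sending \<open>bK\<close> to \<open>xK\<close>. Then \<open>g\<close> is in \<open>K\<close>
    and \<open>x = g b k\<close> with \<open>k\<close> in \<open>K\<close>, so
    \<open>Dab_mult_r\<close> puts \<open>x\<close> in the double coset of
    \<open>g k b\<close>.\<close>
  have cover: "\<exists>a\<in>K. x \<in> D (a \<otimes> b)" if x: "x \<in> carrier G" "x \<notin> K" for x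
  proof -
    have cos: "K \<in> lcosets K" "x <# K \<in> lcosets K" "b <# K \<in> lcosets K"
      using lcosetsI[of \<one> K] lcosetsI x b lcos_mult_one[OF subgroup.subset[OF subgroup_K]] by auto
    have ne: "y <# K \<noteq> K" if "y \<in> carrier G" "y \<notin> K" for y
      using lcos_self[OF that(1) subgroup_K] that by auto
    obtain g where g: "g \<in> carrier G" "g <# K = K" "g <# (b <# K) = x <# K"
      using H1 cos ne[OF x] ne[OF b] unfolding doubly_transitive_def by metis
    have gK: "g \<in> K" using g lcos_self[OF g(1) subgroup_K] by auto
    have "(g \<otimes> b) <# K = x <# K"
      using g lcos_m_assoc[OF subgroup.subset[OF subgroup_K] g(1) b(1)] by simp
    then have kK: "inv (g \<otimes> b) \<otimes> x \<in> K" using coset_eq_iff[OF _ _ subgroup_K, of "g \<otimes> b" x] g x b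
      K_inv[of "inv x \<otimes> (g \<otimes> b)"] by (simp add: inv_mult_group m_assoc)
    have "(g \<otimes> b) \<otimes> (inv (g \<otimes> b) \<otimes> x) \<in> D (g \<otimes> (inv (g \<otimes> b) \<otimes> x) \<otimes> b)"
      by (rule Dab_mult_r[OF D_self[OF abG[OF gK]] gK kK])
    moreover have "(g \<otimes> b) \<otimes> (inv (g \<otimes> b) \<otimes> x) = x" using g x b by (simp add: mult_inv_cancel)
    ultimately show ?thesis using K_mult[OF gK kK] by metis
  qed
  text \<open>\<open>\<theta> x\<close> is the class in \<open>\<Gamma>\<close> of the elements \<open>a \<in> K\<close> with \<open>x \<in> HabH\<close>.\<close>
  define \<theta> where "\<theta> x = \<kappa> (SOME a. a \<in> K \<and> x \<in> D (a \<otimes> b))" for x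
  have \<theta>_iff: "x \<in> D (a \<otimes> b) \<longleftrightarrow> \<kappa> a = \<theta> x" if x: "x \<in> carrier G" "x \<notin> K" and a: "a \<in> K" for x a
  proof -
    define c where "c = (SOME a. a \<in> K \<and> x \<in> D (a \<otimes> b))"
    have c: "c \<in> K" "x \<in> D (c \<otimes> b)" using someI_ex[of "\<lambda>a. a \<in> K \<and> x \<in> D (a \<otimes> b)"] cover[OF x]
      unfolding c_def by blast+
    have "\<theta> x = \<kappa> c" by (simp add: \<theta>_def c_def)
    then show ?thesis using Dab_eq[OF a c(1)] Dab_disj[OF _ c(2) a c(1)] c(2) by auto
  qed
  have \<theta>_ex: "\<exists>a\<in>K. x \<in> D (a \<otimes> b) \<and> \<kappa> a = \<theta> x" if x: "x \<in> carrier G" "x \<notin> K" for x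
    using cover[OF x] \<theta>_iff[OF x] by blast
  have \<theta>: "\<theta> x \<in> carrier \<Gamma>" if x: "x \<in> carrier G" "x \<notin> K" for x
    using \<theta>_ex[OF x] \<kappa> by metis
  \<comment> \<open>Together with \<open>\<theta>_l\<close> and \<open>\<theta>_inv\<close> this is
    all that the entries of the roux require of \<open>\<theta>\<close>.\<close>
  have \<theta>_r: "\<theta> (x \<otimes> c) = \<theta> x \<otimes>\<^bsub>\<Gamma>\<^esub> \<kappa> c" if x: "x \<in> carrier G" "x \<notin> K" and c: "c \<in> K" for x c
  proof -
    obtain a where a: "a \<in> K" "x \<in> D (a \<otimes> b)" "\<kappa> a = \<theta> x" using \<theta>_ex[OF x] by blast
    note xc = Dab_mult_r[OF a(2,1) c]
    show ?thesis
      using \<theta>_iff[OF D_carrier[OF abG[OF K_mult[OF a(1) c]] xc] Dab_notK[OF xc K_mult[OF a(1) c]] K_mult[OF a(1) c]]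
        xc a \<kappa>_mult[OF a(1) c] by simp
  qed
  have \<theta>_l: "\<theta> (c \<otimes> x) = \<kappa> c \<otimes>\<^bsub>\<Gamma>\<^esub> \<theta> x" if x: "x \<in> carrier G" "x \<notin> K" and c: "c \<in> K" for x c
  proof -
    obtain a where a: "a \<in> K" "x \<in> D (a \<otimes> b)" "\<kappa> a = \<theta> x" using \<theta>_ex[OF x] by blast
    note xc = Dab_mult_l[OF a(2,1) c]
    show ?thesis
      using \<theta>_iff[OF D_carrier[OF abG[OF K_mult[OF c a(1)]] xc] Dab_notK[OF xc K_mult[OF c a(1)]] K_mult[OF c a(1)]]
        xc a \<kappa>_mult[OF c a(1)] by simp
  qed
  have \<theta>_inv: "\<theta> (inv x) = inv\<^bsub>\<Gamma>\<^esub> \<theta> x" if x: "x \<in> carrier G" "x \<notin> K" for x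
  proof -
    obtain a where a: "a \<in> K" "x \<in> D (a \<otimes> b)" "\<kappa> a = \<theta> x" using \<theta>_ex[OF x] by blast
    note xi = Dab_inv[OF a(2,1)]
    show ?thesis
      using \<theta>_iff[OF _ Dab_notK[OF xi K_inv[OF a(1)]] K_inv[OF a(1)]] xi a x \<kappa>_inv[OF a(1)] by simp
  qed
  define n where "n = card (lcosets K)"
  have fin_cos: "finite (lcosets K)" using finite_carrier by (auto simp: LCOSETS_def)
  have "3 \<le> n"
  proof -
    \<comment> \<open>The third coset is \<open>hbK\<close>, besides \<open>K\<close> and
      \<open>bK\<close>. If no such \<open>h\<close> existed, each \<open>k = b^(-1) h b\<close>
      would be in \<open>K\<close>; as \<open>b k = h b\<close> lies in both \<open>HkbH\<close> and
      \<open>HbH\<close>, so does \<open>k b\<close>, and (H5) gives \<open>k \<in> H\<close>. Then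
      \<open>b\<close> would normalize \<open>H\<close>.\<close>
    have "\<exists>h\<in>H. inv b \<otimes> (h \<otimes> b) \<notin> K"
    proof (rule ccontr)
      assume "\<not> ?thesis"
      then have k: "inv b \<otimes> (h \<otimes> b) \<in> K" if "h \<in> H" for h using that by blast
      have "inv b \<otimes> h \<otimes> b \<in> H" if h: "h \<in> H" for h
      proof (rule H5)
        show kK: "inv b \<otimes> h \<otimes> b \<in> K" using k[OF h] h H_carrier b by (simp add: m_assoc)
        have "b \<in> D (\<one> \<otimes> b)" using D_self b by simp
        then have "b \<otimes> (inv b \<otimes> h \<otimes> b) \<in> D (\<one> \<otimes> (inv b \<otimes> h \<otimes> b) \<otimes> b)" by (rule Dab_mult_r[OF _ K_one kK])
        then have "h \<otimes> b \<in> D (inv b \<otimes> h \<otimes> b \<otimes> b)" using h H_carrier b by (simp add: group_word)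
        moreover have "h \<otimes> b \<in> D b" using D_closed_l[OF D_self[OF b(1)] b(1) h] .
        ultimately have "D (inv b \<otimes> h \<otimes> b \<otimes> b) = D b"
          using D_eq abG[OF kK] b by metis
        then show "inv b \<otimes> h \<otimes> b \<otimes> b \<in> D b" using D_self[OF abG[OF kK]] by simp
      qed
      then show False using normalizerI b by blast
    qed
    then obtain h where h: "h \<in> H" "inv b \<otimes> (h \<otimes> b) \<notin> K" by blast
    have hb: "h \<otimes> b \<in> carrier G" using h H_carrier b by simp
    have "h \<otimes> b \<notin> K"
      using K_mult[OF K_inv[OF H_K[OF h(1)]], of "h \<otimes> b"] h H_carrier b by (auto simp: inv_mult_cancel)
    then have "\<one> <# K \<noteq> b <# K" "\<one> <# K \<noteq> (h \<otimes> b) <# K" "b <# K \<noteq> (h \<otimes> b) <# K"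
      using coset_eq_iff[OF _ _ subgroup_K, of b \<one>] coset_eq_iff[OF _ _ subgroup_K, of "h \<otimes> b" \<one>]
        coset_eq_iff[OF _ _ subgroup_K, of "h \<otimes> b" b] h b hb by auto
    then have "card {\<one> <# K, b <# K, (h \<otimes> b) <# K} = 3" by simp
    moreover have "{\<one> <# K, b <# K, (h \<otimes> b) <# K} \<subseteq> lcosets K" using lcosetsI hb b by simp
    ultimately show ?thesis unfolding n_def using card_mono[OF fin_cos] by metis
  qed
  obtain \<epsilon> where \<epsilon>: "bij_betw \<epsilon> {..<n} (lcosets K)"
    using ex_bij_betw_nat_finite[OF fin_cos] unfolding n_def atLeast0LessThan by blast
  define rep where "rep i = (SOME x. x \<in> carrier G \<and> \<epsilon> i = x <# K)" for i
  have rep: "rep i \<in> carrier G \<and> \<epsilon> i = rep i <# K" if "i < n" for i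
    unfolding rep_def
  proof (rule someI_ex)
    have "\<epsilon> i \<in> lcosets K" using \<epsilon> that by (auto simp: bij_betw_def)
    then show "\<exists>x. x \<in> carrier G \<and> \<epsilon> i = x <# K" by (auto elim: lcosetsE)
  qed
  have rep_G: "rep i \<in> carrier G" if "i < n" for i using rep[OF that] by simp
  have rep_eq: "inv (rep j) \<otimes> rep i \<in> K \<longleftrightarrow> i = j" if "i < n" "j < n" for i j
  proof -
    have "\<epsilon> i = \<epsilon> j \<longleftrightarrow> i = j" using \<epsilon> that by (auto simp: bij_betw_def inj_on_def)
    then show ?thesis using rep[OF that(1)] rep[OF that(2)] coset_eq_iff[OF _ _ subgroup_K] by metis
  qed
  have rep_ex: "\<exists>i<n. inv (rep i) \<otimes> x \<in> K" if x: "x \<in> carrier G" for x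
  proof -
    have "x <# K \<in> \<epsilon> ` {..<n}" using \<epsilon> lcosetsI[OF x] by (auto simp: bij_betw_def)
    then obtain i where "i < n" "x <# K = \<epsilon> i" by auto
    then show ?thesis using rep[of i] coset_eq_iff[OF x _ subgroup_K] by metis
  qed
  define sec where "sec u = (SOME a. a \<in> K \<and> \<kappa> a = u)" for u
  have sec: "sec u \<in> K" "\<kappa> (sec u) = u" if "u \<in> carrier \<Gamma>" for u
  proof -
    have "\<exists>a. a \<in> K \<and> \<kappa> a = u" using that unfolding \<kappa>_im[symmetric] by auto
    then have "sec u \<in> K \<and> \<kappa> (sec u) = u" unfolding sec_def by (rule someI_ex)
    then show "sec u \<in> K" "\<kappa> (sec u) = u" by blast+
  qed
  define Y where "Y = {..<n} \<times> carrier \<Gamma>"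
  \<comment> \<open>The cosets of \<open>H\<close> inside \<open>rep i <# K\<close> are indexed by
    \<open>K/H\<close>, so \<open>rep i\<close> times a representative of the class \<open>u\<close>
    meets each coset of \<open>H\<close> exactly once.\<close>
  define F where "F = (\<lambda>(i, u). (rep i \<otimes> sec u) <# H)"
  have pt: "rep i \<otimes> sec u \<in> carrier G" if "i < n" "u \<in> carrier \<Gamma>" for i u
    using rep_G[OF that(1)] sec[OF that(2)] K_carrier by simp
  have word: "inv (rep j \<otimes> sec v) \<otimes> (rep i \<otimes> sec u) = inv (sec v) \<otimes> (inv (rep j) \<otimes> rep i) \<otimes> sec u"
    if "i < n" "j < n" "u \<in> carrier \<Gamma>" "v \<in> carrier \<Gamma>" for i j u v
    using rep_G that sec K_carrier by (simp add: group_word)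
  have F: "bij_betw F Y (lcosets H)"
    unfolding bij_betw_def
  proof
    show "inj_on F Y"
    proof (rule inj_onI)
      fix p q assume "p \<in> Y" "q \<in> Y" and eq: "F p = F q"
      then obtain i u j v where p: "p = (i, u)" "i < n" "u \<in> carrier \<Gamma>"
        and q: "q = (j, v)" "j < n" "v \<in> carrier \<Gamma>" by (auto simp: Y_def)
      note su = sec[OF p(3)] and sv = sec[OF q(3)]
      note car = K_carrier[OF su(1)] K_carrier[OF sv(1)] rep_G[OF p(2)] rep_G[OF q(2)]
      have h: "inv (sec v) \<otimes> (inv (rep j) \<otimes> rep i) \<otimes> sec u \<in> H"
        using eq coset_eq_iff[OF pt[OF p(2,3)] pt[OF q(2,3)] subgroup_H] word[OF p(2) q(2) p(3) q(3)]
        by (simp add: F_def p q)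
      have "inv (rep j) \<otimes> rep i = sec v \<otimes> (inv (sec v) \<otimes> (inv (rep j) \<otimes> rep i) \<otimes> sec u) \<otimes> inv (sec u)"
        using car by (simp add: group_word)
      also have "\<dots> \<in> K" using H_K[OF h] su sv K_mult K_inv by simp
      finally have ij: "i = j" using rep_eq p q by simp
      then have "inv (sec v) \<otimes> sec u \<in> H" using h car by simp
      then have "u = v" using \<kappa>_eq[OF su(1) sv(1)] su sv by simp
      then show "p = q" using ij p q by simp
    qed
    show "F ` Y = lcosets H"
    proof
      show "F ` Y \<subseteq> lcosets H" using pt lcosetsI by (auto simp: F_def Y_def)
      show "lcosets H \<subseteq> F ` Y"
      proof
        fix U assume "U \<in> lcosets H"
        then obtain x where x: "x \<in> carrier G" "U = x <# H" by (rule lcosetsE)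
        obtain i where i: "i < n" "inv (rep i) \<otimes> x \<in> K" using rep_ex[OF x(1)] by blast
        define u where "u = \<kappa> (inv (rep i) \<otimes> x)"
        have u: "u \<in> carrier \<Gamma>" using \<kappa> i by (simp add: u_def)
        have "inv (sec u) \<otimes> (inv (rep i) \<otimes> x) \<in> H"
          using \<kappa>_eq[OF i(2) sec(1)[OF u]] sec(2)[OF u] by (simp add: u_def)
        then have "inv (rep i \<otimes> sec u) \<otimes> x \<in> H"
          using rep_G[OF i(1)] K_carrier[OF sec(1)[OF u]] x(1) by (simp add: group_word)
        then have "F (i, u) = U"
          using coset_eq_iff[OF x(1) pt[OF i(1) u] subgroup_H] x(2) by (simp add: F_def)
        then show "U \<in> F ` Y" using i u by (auto simp: Y_def)
      qed
    qed
  qed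
  \<comment> \<open>The inverse is forced. For points \<open>(i, u)\<close> and
    \<open>(j, v)\<close> the class of the connecting element is \<open>v^(-1) t u\<close>, where
    \<open>t\<close> is \<open>\<theta>\<close> of \<open>inv (rep j) \<otimes> rep i\<close>.
    Equating it with \<open>\<kappa> a\<close> and solving for \<open>u\<close> gives
    \<open>\<kappa> a\<close> times \<open>t^(-1)\<close> times \<open>v\<close>.\<close>
  define \<beta> where "\<beta> i j = inv\<^bsub>\<Gamma>\<^esub> \<theta> (inv (rep j) \<otimes> rep i)" for i j
  have off: "inv (rep j) \<otimes> rep i \<in> carrier G" "inv (rep j) \<otimes> rep i \<notin> K" if "i < n" "j < n" "i \<noteq> j" for i j
    using that rep_G rep_eq by auto
  have \<beta>: "\<beta> i j \<in> carrier \<Gamma>" if "i < n" "j < n" "i \<noteq> j" for i j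
    using \<theta>[OF off[OF that]] by (simp add: \<beta>_def)
  have \<beta>_inv: "\<beta> j i = inv\<^bsub>\<Gamma>\<^esub> \<beta> i j" if "i < n" "j < n" "i \<noteq> j" for i j
  proof -
    have "inv (rep i) \<otimes> rep j = inv (inv (rep j) \<otimes> rep i)"
      using rep_G that by (simp add: inv_mult_group)
    then show ?thesis using \<theta>_inv[OF off[OF that]] by (simp add: \<beta>_def)
  qed
  have adj_F: "pullback Y F (adj a) (i, u) (j, v) =
      (if inv (sec v) \<otimes> (inv (rep j) \<otimes> rep i) \<otimes> sec u \<in> D a then 1 else 0)"
    if "a \<in> carrier G" "i < n" "j < n" "u \<in> carrier \<Gamma>" "v \<in> carrier \<Gamma>" for a i j u v
    using that pt by (simp add: pullback_apply Y_def F_def adj_eq word)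
  have pull_I: "pullback Y F (adj a) = grmat_lift \<Gamma> (grmat_smult \<Gamma> (\<kappa> a) (grmat_id \<Gamma> n))"
    if a: "a \<in> K" for a
  proof (intro ext)
    fix p q :: "nat \<times> nat"
    obtain i u j v where pq: "p = (i, u)" "q = (j, v)" by (cases p, cases q)
    show "pullback Y F (adj a) p q = grmat_lift \<Gamma> (grmat_smult \<Gamma> (\<kappa> a) (grmat_id \<Gamma> n)) p q"
    proof (cases "i < n \<and> j < n \<and> u \<in> carrier \<Gamma> \<and> v \<in> carrier \<Gamma>")
      case True
      define z where "z = inv (sec v) \<otimes> (inv (rep j) \<otimes> rep i) \<otimes> sec u"
      have su: "sec u \<in> K" "\<kappa> (sec u) = u" and sv: "sec v \<in> K" "\<kappa> (sec v) = v"
        using sec True by auto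
      have car: "sec u \<in> carrier G" "sec v \<in> carrier G" "rep i \<in> carrier G" "rep j \<in> carrier G"
        using K_carrier su sv rep_G True by auto
      have "z \<in> D a \<longleftrightarrow> i = j \<and> u = \<kappa> a \<otimes>\<^bsub>\<Gamma>\<^esub> v"
      proof (cases "i = j")
        case True
        have z: "z = inv (sec v) \<otimes> sec u" using car True by (simp add: z_def)
        have zK: "z \<in> K" unfolding z using su sv K_mult K_inv by simp
        have "\<kappa> z = inv\<^bsub>\<Gamma>\<^esub> v \<otimes>\<^bsub>\<Gamma>\<^esub> u" unfolding z using su sv \<kappa>_mult K_inv \<kappa>_inv by simp
        moreover have "z \<in> D a \<longleftrightarrow> \<kappa> z = \<kappa> a"
          using D_K_iff[OF a K_carrier[OF zK]] \<kappa>_eq[OF zK a] by simp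
        moreover have "inv\<^bsub>\<Gamma>\<^esub> v \<otimes>\<^bsub>\<Gamma>\<^esub> u = \<kappa> a \<longleftrightarrow> u = \<kappa> a \<otimes>\<^bsub>\<Gamma>\<^esub> v"
          using \<kappa>[OF a] \<kappa>[OF su(1)] \<kappa>[OF sv(1)] su sv
          by (metis \<Gamma>.inv_closed \<Gamma>.inv_solve_left \<Gamma>.m_comm)
        ultimately show ?thesis using True by simp
      next
        case False
        have "z \<notin> K"
        proof
          assume "z \<in> K"
          moreover have "inv (rep j) \<otimes> rep i = sec v \<otimes> z \<otimes> inv (sec u)"
            unfolding z_def using car by (simp add: group_word)
          ultimately have "inv (rep j) \<otimes> rep i \<in> K" using su sv K_mult K_inv by simp
          then show False using rep_eq True False \<open>i < n \<and> j < n \<and> _\<close> by blast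
        qed
        \<comment> \<open>Here \<open>HaH = aH\<close> stays inside \<open>K\<close>, whereas
          \<open>z\<close> connects different cosets of \<open>K\<close>.\<close>
        moreover have "z \<in> K" if "z \<in> D a"
        proof -
          have zc: "z \<in> carrier G" using car by (simp add: z_def)
          have "z = a \<otimes> (inv a \<otimes> z)" using zc K_carrier[OF a] by (simp add: mult_inv_cancel)
          moreover have "inv a \<otimes> z \<in> K" using D_K_iff[OF a zc] that H_K by blast
          ultimately show ?thesis using K_mult[OF a] by metis
        qed
        ultimately show ?thesis using False by blast
      qed
      then show ?thesis using True K_carrier[OF a] \<kappa>[OF a]
        by (simp add: pq adj_F lift_smult_id[OF \<Gamma>.is_group fin] z_def)
    next
      case False
      then show ?thesis using \<kappa>[OF a]
        by (auto simp: pq pullback_def Y_def lift_smult_id[OF \<Gamma>.is_group fin])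
    qed
  qed
  have pull_B: "pullback Y F (adj (a \<otimes> b)) = grmat_lift \<Gamma> (grmat_smult \<Gamma> (\<kappa> a) (phase_matrix n \<beta>))"
    if a: "a \<in> K" for a
  proof (intro ext)
    fix p q :: "nat \<times> nat"
    obtain i u j v where pq: "p = (i, u)" "q = (j, v)" by (cases p, cases q)
    show "pullback Y F (adj (a \<otimes> b)) p q = grmat_lift \<Gamma> (grmat_smult \<Gamma> (\<kappa> a) (phase_matrix n \<beta>)) p q"
    proof (cases "i < n \<and> j < n \<and> u \<in> carrier \<Gamma> \<and> v \<in> carrier \<Gamma>")
      case True
      define z where "z = inv (sec v) \<otimes> (inv (rep j) \<otimes> rep i) \<otimes> sec u"
      have su: "sec u \<in> K" "\<kappa> (sec u) = u" and sv: "sec v \<in> K" "\<kappa> (sec v) = v"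
        using sec True by auto
      have car: "sec u \<in> carrier G" "sec v \<in> carrier G" "rep i \<in> carrier G" "rep j \<in> carrier G"
        using K_carrier su sv rep_G True by auto
      have zc: "z \<in> carrier G" using car by (simp add: z_def)
      have "z \<in> D (a \<otimes> b) \<longleftrightarrow> i \<noteq> j \<and> u = \<kappa> a \<otimes>\<^bsub>\<Gamma>\<^esub> \<beta> i j \<otimes>\<^bsub>\<Gamma>\<^esub> v"
      proof (cases "i = j")
        case True
        have "z = inv (sec v) \<otimes> sec u" using car True by (simp add: z_def)
        then have "z \<in> K" using su sv K_mult K_inv by simp
        then show ?thesis using Dab_notK[OF _ a] True by blast
      next
        case False
        define y where "y = inv (rep j) \<otimes> rep i"
        have y: "y \<in> carrier G" "y \<notin> K" unfolding y_def using off True False by blast+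
        have "inv (sec v) \<otimes> y \<notin> K"
        proof
          assume "inv (sec v) \<otimes> y \<in> K"
          then have "sec v \<otimes> (inv (sec v) \<otimes> y) \<in> K" by (rule K_mult[OF sv(1)])
          then show False using y car by (simp add: mult_inv_cancel)
        qed
        moreover have "inv (sec v) \<otimes> y \<in> carrier G" using car y by simp
        ultimately have "\<theta> z = inv\<^bsub>\<Gamma>\<^esub> v \<otimes>\<^bsub>\<Gamma>\<^esub> \<theta> y \<otimes>\<^bsub>\<Gamma>\<^esub> u"
          unfolding z_def y_def[symmetric] using \<theta>_r \<theta>_l[OF y K_inv[OF sv(1)]] su sv \<kappa>_inv by simp
        moreover have "z \<notin> K"
        proof
          assume "z \<in> K"
          then have "sec v \<otimes> z \<otimes> inv (sec u) \<in> K" using su sv K_mult K_inv by simp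
          then show False using y car unfolding z_def y_def[symmetric] by (simp add: group_word)
        qed
        ultimately have "z \<in> D (a \<otimes> b) \<longleftrightarrow> \<kappa> a = inv\<^bsub>\<Gamma>\<^esub> v \<otimes>\<^bsub>\<Gamma>\<^esub> \<theta> y \<otimes>\<^bsub>\<Gamma>\<^esub> u"
          using \<theta>_iff[OF zc _ a] by simp
        also have "\<dots> \<longleftrightarrow> u = \<kappa> a \<otimes>\<^bsub>\<Gamma>\<^esub> \<beta> i j \<otimes>\<^bsub>\<Gamma>\<^esub> v"
        proof -
          have c: "u \<in> carrier \<Gamma>" "v \<in> carrier \<Gamma>" "\<theta> y \<in> carrier \<Gamma>" "\<kappa> a \<in> carrier \<Gamma>"
            using \<open>i < n \<and> j < n \<and> _\<close> \<theta>[OF y] \<kappa>[OF a] by auto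
          have "u = \<kappa> a \<otimes>\<^bsub>\<Gamma>\<^esub> inv\<^bsub>\<Gamma>\<^esub> \<theta> y \<otimes>\<^bsub>\<Gamma>\<^esub> v" if "\<kappa> a = inv\<^bsub>\<Gamma>\<^esub> v \<otimes>\<^bsub>\<Gamma>\<^esub> \<theta> y \<otimes>\<^bsub>\<Gamma>\<^esub> u"
          proof -
            \<comment> \<open>Inverse pairs are left standing so that both sides are the same
              product up to order; they cancel in the next step.\<close>
            have "\<kappa> a \<otimes>\<^bsub>\<Gamma>\<^esub> inv\<^bsub>\<Gamma>\<^esub> \<theta> y \<otimes>\<^bsub>\<Gamma>\<^esub> v = u \<otimes>\<^bsub>\<Gamma>\<^esub> ((\<theta> y \<otimes>\<^bsub>\<Gamma>\<^esub> inv\<^bsub>\<Gamma>\<^esub> \<theta> y) \<otimes>\<^bsub>\<Gamma>\<^esub> (v \<otimes>\<^bsub>\<Gamma>\<^esub> inv\<^bsub>\<Gamma>\<^esub> v))"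
              unfolding that using c by (simp add: \<Gamma>.m_ac del: \<Gamma>.r_inv \<Gamma>.Units_r_inv)
            then show ?thesis using c by simp
          qed
          moreover have "\<kappa> a = inv\<^bsub>\<Gamma>\<^esub> v \<otimes>\<^bsub>\<Gamma>\<^esub> \<theta> y \<otimes>\<^bsub>\<Gamma>\<^esub> u" if "u = \<kappa> a \<otimes>\<^bsub>\<Gamma>\<^esub> inv\<^bsub>\<Gamma>\<^esub> \<theta> y \<otimes>\<^bsub>\<Gamma>\<^esub> v"
          proof -
            have "inv\<^bsub>\<Gamma>\<^esub> v \<otimes>\<^bsub>\<Gamma>\<^esub> \<theta> y \<otimes>\<^bsub>\<Gamma>\<^esub> (\<kappa> a \<otimes>\<^bsub>\<Gamma>\<^esub> inv\<^bsub>\<Gamma>\<^esub> \<theta> y \<otimes>\<^bsub>\<Gamma>\<^esub> v)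
                = \<kappa> a \<otimes>\<^bsub>\<Gamma>\<^esub> ((\<theta> y \<otimes>\<^bsub>\<Gamma>\<^esub> inv\<^bsub>\<Gamma>\<^esub> \<theta> y) \<otimes>\<^bsub>\<Gamma>\<^esub> (v \<otimes>\<^bsub>\<Gamma>\<^esub> inv\<^bsub>\<Gamma>\<^esub> v))"
              using c by (simp add: \<Gamma>.m_ac del: \<Gamma>.r_inv \<Gamma>.Units_r_inv)
            then show ?thesis using c that by simp
          qed
          ultimately show ?thesis unfolding \<beta>_def y_def[symmetric] by blast
        qed
        finally show ?thesis using False by simp
      qed
      then show ?thesis using True abG[OF a] \<kappa>[OF a]
        by (simp add: pq adj_F lift_smult_phase_matrix[OF \<Gamma>.is_group fin _ \<beta>] z_def)
    next
      case False
      then show ?thesis using \<kappa>[OF a]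
        by (auto simp: pq pullback_def Y_def lift_smult_phase_matrix[OF \<Gamma>.is_group fin _ \<beta>])
    qed
  qed
  \<comment> \<open>The double cosets split into those inside \<open>K\<close>, matched with the
    \<open>gI\<close>, and by \<open>cover\<close> the sets \<open>HabH\<close>, matched with the
    \<open>gB\<close>; surjectivity of \<open>\<kappa>\<close> reaches every
    \<open>g\<close>.\<close>
  have img: "pullback Y F ` adj ` carrier G = grmat_lift \<Gamma> ` roux_gens \<Gamma> n (phase_matrix n \<beta>)"
  proof
    show "pullback Y F ` adj ` carrier G \<subseteq> grmat_lift \<Gamma> ` roux_gens \<Gamma> n (phase_matrix n \<beta>)"
    proof clarify
      fix x assume x: "x \<in> carrier G"
      show "pullback Y F (adj x) \<in> grmat_lift \<Gamma> ` roux_gens \<Gamma> n (phase_matrix n \<beta>)"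
      proof (cases "x \<in> K")
        case True
        then show ?thesis unfolding pull_I[OF True] roux_gens_def using \<kappa>[OF True] by blast
      next
        case False
        then obtain a where a: "a \<in> K" "x \<in> D (a \<otimes> b)" using cover x by blast
        then have "D x = D (a \<otimes> b)" using D_eq abG by blast
        then have "pullback Y F (adj x) = grmat_lift \<Gamma> (grmat_smult \<Gamma> (\<kappa> a) (phase_matrix n \<beta>))"
          using pull_B[OF a(1)] by simp
        then show ?thesis unfolding roux_gens_def using \<kappa>[OF a(1)] by blast
      qed
    qed
    show "grmat_lift \<Gamma> ` roux_gens \<Gamma> n (phase_matrix n \<beta>) \<subseteq> pullback Y F ` adj ` carrier G"
    proof -
      have "grmat_lift \<Gamma> (grmat_smult \<Gamma> g (grmat_id \<Gamma> n)) \<in> pullback Y F ` adj ` carrier G \<and>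
          grmat_lift \<Gamma> (grmat_smult \<Gamma> g (phase_matrix n \<beta>)) \<in> pullback Y F ` adj ` carrier G"
        if g: "g \<in> carrier \<Gamma>" for g
      proof -
        obtain a where a: "a \<in> K" "g = \<kappa> a" using \<kappa>_im g by blast
        show ?thesis unfolding a(2) pull_I[OF a(1), symmetric] pull_B[OF a(1), symmetric]
          using K_carrier[OF a(1)] abG[OF a(1)] by blast
      qed
      then show ?thesis unfolding roux_gens_def by blast
    qed
  qed
  have assoc: "association_scheme (roux_scheme \<Gamma> n (phase_matrix n \<beta>))"
    using association_scheme_pullback[OF association_scheme_schurian[unfolded schurian_scheme_def] F]
    unfolding img by (simp add: roux_scheme_def Y_def)
  have "roux \<Gamma> n (phase_matrix n \<beta>)"
    by (rule roux_phase_matrixI[OF comm fin \<beta> \<beta>_inv assoc])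
  moreover have "scheme_isomorphic (schurian_scheme G H) (roux_scheme \<Gamma> n (phase_matrix n \<beta>))"
    using association_scheme_schurian assoc F img
    unfolding schurian_scheme_def roux_scheme_def scheme_isomorphic_iff_pullback Y_def by blast
  ultimately show ?thesis using \<open>3 \<le> n\<close> by blast
qed

end

theorem theorem2p1:
  fixes G :: "('a, 'b) monoid_scheme" and H :: "'a set"
  assumes "group G" and "finite (carrier G)" and "subgroup H G"
  shows "(\<exists>(\<Gamma> :: nat monoid) n B. n \<ge> 3 \<and> roux \<Gamma> n B \<and>
            scheme_isomorphic (schurian_scheme G H) (roux_scheme \<Gamma> n B))
         \<longleftrightarrow> higman_pair G H"
proof -
  interpret finite_group_pair G H
    using assms by (simp add: finite_group_pair_def finite_group_pair_axioms_def)
  show ?thesis using roux_imp_higman_pair higman_pair_imp_roux by blast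
qed

end
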